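(* Let $f\colon\mathbb R^m\times\mathbb R^k\to\mathbb R^k$ be a smooth map such that $0$ is a regular value of $f$. Assume that $M=f^{-1}(0)$ is connected and locally bounded over $\mathbb R^m$. Let $\pi\colon M\to\mathbb R^m$ be the restriction to $M$ of the projection $(x,p)\mapsto x$, let $\mathcal B\subset M$ be the set of branch points of $\pi$, and for $x\in\mathbb R^m$ let $f_x\colon\mathbb R^k\to\mathbb R^k$, $f_x(p)=f(x,p)$. If $m_*=(x_*,p_* )\in M$ verifies (i) $\operatorname{Ker}Df_{x_*}(p_* )$ is odd-dimensional; (ii) there exists a vector $v\in\operatorname{Ker}Df_{x_*}(p_* )$ such that $$D^2f_{x_*}(p_* )[v,u]\notin\operatorname{Im}Df_{x_*}(p_* )\quad\text{for all }u\in\operatorname{Ker}Df_{x_*}(p_* ),\ u\ne0,$$ then $m_*\in\mathcal B$. Moreover, in every neighbourhood of $m_*$ in $M$ there are two regular points $m_+$ and $m_-$ of $\pi$ belonging to different path components of $M\setminus\mathcal B$. In particular, $\mathcal B$ separates $M$.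
   Context: $M$ is an $m$-dimensional smooth submanifold of $\mathbb R^{m+k}$ since $0$ is a regular value of $f$. "$M$ is locally bounded over $\mathbb R^m$" means that every point $y\in\mathbb R^m$ has a neighbourhood $U$ such that $M\cap(U\times\mathbb R^k)$ is bounded in $\mathbb R^{m+k}$. A branch point of $\pi$ is a point at which $\pi$ fails to be a local homeomorphism. A regular point of $\pi$ is a point where $D\pi$ is an isomorphism. $D f_{x_*}(p_* )$ and $D^2f_{x_*}(p_* )$ denote the first and second differentials of $f_{x_*}$ at $p_*$. *)

theory Defs
  imports "HOL-Analysis.Analysis"
begin

text \<open>
  A map is of class \<open>C\<^sup>n\<^sup>+\<^sup>1\<close> iff it is differentiable and all its directional derivatives are
  of class \<open>C\<^sup>n\<close>; the domain is finite-dimensional, so this agrees with the usual notion.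
\<close>

primrec Ck_map :: "nat \<Rightarrow> ('a::euclidean_space \<Rightarrow> 'b::euclidean_space) \<Rightarrow> bool" where
  "Ck_map 0 f \<longleftrightarrow> continuous_on UNIV f"
| "Ck_map (Suc n) f \<longleftrightarrow>
     (\<forall>x. f differentiable (at x)) \<and> (\<forall>v. Ck_map n (\<lambda>x. frechet_derivative f (at x) v))"

definition smooth_map :: "('a::euclidean_space \<Rightarrow> 'b::euclidean_space) \<Rightarrow> bool" where
  "smooth_map f \<longleftrightarrow> (\<forall>n. Ck_map n f)"

definition regular_value :: "('a::euclidean_space \<Rightarrow> 'b::euclidean_space) \<Rightarrow> 'b \<Rightarrow> bool" where
  "regular_value f c \<longleftrightarrow> (\<forall>z. f z = c \<longrightarrow> surj (frechet_derivative f (at z)))"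

definition locally_bounded_over_base :: "('a::euclidean_space \<times> 'b::euclidean_space) set \<Rightarrow> bool" where
  "locally_bounded_over_base M \<longleftrightarrow>
     (\<forall>y. \<exists>U. open U \<and> y \<in> U \<and> bounded (M \<inter> (U \<times> UNIV)))"

text \<open>
  The restriction of \<open>f\<close> to \<open>M\<close>, as a map into the whole target space, is a local homeomorphism
  at \<open>z\<close>: it maps some neighbourhood of \<open>z\<close> in \<open>M\<close> homeomorphically onto an open set.
\<close>

definition local_homeomorphism_at ::
    "'a::topological_space set \<Rightarrow> ('a \<Rightarrow> 'b::topological_space) \<Rightarrow> 'a \<Rightarrow> bool" where
  "local_homeomorphism_at M f z \<longleftrightarrow>
     (\<exists>U V g. openin (top_of_set M) U \<and> z \<in> U \<and> open V \<and> homeomorphism U V f g)"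

definition branch_points ::
    "'a::topological_space set \<Rightarrow> ('a \<Rightarrow> 'b::topological_space) \<Rightarrow> 'a set" where
  "branch_points M f = {z \<in> M. \<not> local_homeomorphism_at M f z}"

text \<open>
  Velocities at \<open>z\<close> of \<open>C\<^sup>1\<close> curves in \<open>M\<close>; for a smooth submanifold \<open>M\<close> this is the
  tangent space of \<open>M\<close> at \<open>z\<close>.
\<close>

definition tangent_space :: "'a::euclidean_space set \<Rightarrow> 'a \<Rightarrow> 'a set" where
  "tangent_space M z =
     {v. \<exists>\<gamma> e. 0 < e \<and> \<gamma> C1_differentiable_on {-e<..<e} \<and> \<gamma> ` {-e<..<e} \<subseteq> M \<and>
         \<gamma> 0 = z \<and> (\<gamma> has_vector_derivative v) (at (0::real))}"

text \<open>
  Here \<open>f\<close> is defined on the ambient space, so the differential at \<open>z\<close> of its restriction to \<open>M\<close>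
  is the ambient (linear) differential restricted to the tangent space of \<open>M\<close>.
\<close>

definition regular_point ::
    "'a::euclidean_space set \<Rightarrow> ('a \<Rightarrow> 'b::euclidean_space) \<Rightarrow> 'a \<Rightarrow> bool" where
  "regular_point M f z \<longleftrightarrow>
     z \<in> M \<and> bij_betw (frechet_derivative f (at z)) (tangent_space M z) UNIV"

text \<open>\<open>D\<^sup>2g(p)[v,u]\<close>: the derivative at \<open>p\<close> in the direction \<open>v\<close> of \<open>q \<mapsto> Dg(q)[u]\<close>.\<close>

definition second_differential ::
    "('a::euclidean_space \<Rightarrow> 'b::euclidean_space) \<Rightarrow> 'a \<Rightarrow> 'a \<Rightarrow> 'a \<Rightarrow> 'b" where
  "second_differential g p v u =
     frechet_derivative (\<lambda>q. frechet_derivative g (at q) u) (at p) v"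

end

theory Submission
  imports Defs "HOL-Homology.Brouwer_Degree"
begin

text \<open>
  If \<open>\<pi>\<close> is a local homeomorphism at \<open>(x, p) \<in> M\<close>, then \<open>p\<close> is an isolated zero of \<open>f\<^sub>x\<close>, and the
  isolation radius can be chosen uniformly along a path in \<open>M - \<B>\<close>. So, for small \<open>r\<close>, the homotopy
  class of \<open>u \<mapsto> f(x, p + r u)\<close>, as a map from the unit sphere of \<open>\<real>\<^sup>k\<close> to \<open>\<real>\<^sup>k - {0}\<close>, is constant along
  the path; where \<open>Df\<^sub>x(p)\<close> is invertible it is the class of \<open>Df\<^sub>x(p)\<close>.

  Let \<open>\<gamma>\<close> be a curve in \<open>M\<close> through \<open>m\<^sub>*\<close> with velocity \<open>(0, v)\<close>, and let \<open>A(t)\<close> be the partial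
  differential at \<open>\<gamma>(t)\<close>. Dividing the directions of \<open>Ker A(0)\<close> by \<open>t\<close> turns \<open>A(t)\<close> into a family that
  converges, as \<open>t \<rightarrow> 0\<close>, to an operator that (ii) makes invertible. Hence \<open>A(t)\<close> and \<open>A(-t)\<close> are
  invertible for small \<open>t > 0\<close>, and up to homotopy they differ by a sign change of as many coordinates
  as the dimension of the kernel. An odd number of sign changes has degree \<open>-1\<close>, so no path in
  \<open>M - \<B>\<close> joins \<open>\<gamma>(t)\<close> to \<open>\<gamma>(-t)\<close>; the arc of \<open>\<gamma>\<close> between them then shows \<open>m\<^sub>* \<in> \<B>\<close>.
\<close>

section \<open>Degree of a change of signs\<close>

lemma nsphere_top_of_set:
  "nsphere p = top_of_set {x. (\<Sum>i\<le>p. (x i)\<^sup>2) = 1 \<and> (\<forall>i>p. x i = 0)}"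
  by (simp add: nsphere euclidean_product_topology)

lemma continuous_map_nsphere_transpose:
  assumes "k \<le> p"
  shows "continuous_map (nsphere p) (nsphere p) (\<lambda>x i. x (Transposition.transpose 0 k i))"
proof -
  have "(\<Sum>i\<le>p. (x (Transposition.transpose 0 k i))\<^sup>2) = (\<Sum>i\<le>p. (x i)\<^sup>2)" for x :: "nat \<Rightarrow> real"
    by (rule sum.reindex_bij_betw) (use assms in \<open>simp add: bij_betw_transpose_iff\<close>)
  moreover have "continuous_on S (\<lambda>x::nat \<Rightarrow> real. \<lambda>i. x (Transposition.transpose 0 k i))" for S
    by (intro continuous_on_coordinatewise_then_product continuous_on_product_coordinates
        continuous_on_subset[of UNIV] subset_UNIV)
  ultimately show ?thesis
    using assms by (auto simp: nsphere_top_of_set Pi_iff Transposition.transpose_def)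
qed

text \<open>The reflection in coordinate \<open>k\<close> is the one in coordinate 0 conjugated by
  the swap of 0 and \<open>k\<close>. Degrees multiply under composition and the swap is an
  involution, so its two factors cancel and the degree of the reflection in coordinate 0
  remains.\<close>

lemma Brouwer_degree2_reflection_coordinate:
  assumes "k \<le> p"
  shows "Brouwer_degree2 p (\<lambda>x i. if i = k then - x i else x i) = -1"
proof -
  define s where "s = (\<lambda>x::nat \<Rightarrow> real. \<lambda>i. x (Transposition.transpose 0 k i))"
  define r where "r = (\<lambda>k (x::nat \<Rightarrow> real) i. if i = k then - x i else x i)"
  have s: "continuous_map (nsphere p) (nsphere p) s"
    unfolding s_def by (rule continuous_map_nsphere_transpose[OF assms])
  have r: "continuous_map (nsphere p) (nsphere p) (r j)" for j
    unfolding r_def by (rule continuous_map_nsphere_reflection)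
  have "s \<circ> s = id"
    by (auto simp: s_def)
  then have ss: "Brouwer_degree2 p s * Brouwer_degree2 p s = 1"
    using Brouwer_degree2_compose[OF s s] by simp
  have "r k = s \<circ> r 0 \<circ> s"
    by (auto simp: r_def s_def fun_eq_iff Transposition.transpose_def)
  then have "Brouwer_degree2 p (r k) = Brouwer_degree2 p s * Brouwer_degree2 p (r 0) * Brouwer_degree2 p s"
    by (simp only: Brouwer_degree2_compose[OF s continuous_map_compose[OF r s]] Brouwer_degree2_compose[OF r s])
  also have "Brouwer_degree2 p (r 0) = -1"
    unfolding r_def by (rule Brouwer_degree2_reflection)
  finally show ?thesis
    using ss by (simp add: r_def)
qed

text \<open>Induction peels off one reflection at a time. Continuity is carried along with the
  degree because the composition law in the induction step needs it.\<close>

lemma Brouwer_degree2_sign_change: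
  assumes "I \<subseteq> {..p}"
  shows "continuous_map (nsphere p) (nsphere p) (\<lambda>x i. if i \<in> I then - x i else x i)
    \<and> Brouwer_degree2 p (\<lambda>x i. if i \<in> I then - x i else x i) = (-1) ^ card I"
proof -
  have "finite I"
    using assms finite_subset by blast
  then show ?thesis
    using assms
  proof (induction I)
    case empty
    then show ?case
      using Brouwer_degree2_id[of p] by (simp add: id_def)
  next
    case (insert k I)
    let ?r = "\<lambda>(x::nat \<Rightarrow> real) i. if i = k then - x i else x i"
    let ?s = "\<lambda>(x::nat \<Rightarrow> real) i. if i \<in> I then - x i else x i"
    have r: "continuous_map (nsphere p) (nsphere p) ?r"
      by (rule continuous_map_nsphere_reflection)
    have s: "continuous_map (nsphere p) (nsphere p) ?s" "Brouwer_degree2 p ?s = (-1) ^ card I"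
      using insert by auto
    have "(\<lambda>(x::nat \<Rightarrow> real) i. if i \<in> insert k I then - x i else x i) = ?r \<circ> ?s"
      using insert.hyps by (auto simp: fun_eq_iff)
    moreover have "Brouwer_degree2 p (?r \<circ> ?s) = (-1) ^ card (insert k I)"
      using insert.prems insert.hyps
      by (simp add: Brouwer_degree2_compose[OF s(1) r] s(2) Brouwer_degree2_reflection_coordinate)
    ultimately show ?case
      using continuous_map_compose[OF s(1) r] by simp
  qed
qed

definition flip :: "'k set \<Rightarrow> real ^ 'k \<Rightarrow> real ^ 'k" where
  "flip J y = (\<chi> i. if i \<in> J then - y $ i else y $ i)"

text \<open>Degree is a homotopy invariant: the identity has degree 1 and the flip
  \<open>(-1) ^ card J\<close>. The work lies in carrying the homotopy over to
  \<open>nsphere p\<close>, whose points are sequences, by enumerating the coordinates.\<close>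

lemma even_card_if_flip_homotopic_id:
  fixes J :: "'k::finite set"
  assumes "homotopic_with_canon (\<lambda>_. True) (sphere 0 1) (sphere 0 1) id (flip J)"
  shows "even (card J)"
proof -
  obtain e :: "'k \<Rightarrow> nat" where e: "bij_betw e UNIV {0..<CARD('k)}"
    using ex_bij_betw_finite_nat[OF finite_class.finite_UNIV] by blast
  \<comment> \<open>The unit sphere in \<open>CARD('k)\<close> dimensions is the sphere of dimension
    one less; \<open>nsphere p\<close> uses the \<open>p + 1\<close> coordinates
    \<open>0, ..., p\<close>.\<close>
  define p where "p = CARD('k) - 1"
  have ep: "bij_betw e UNIV {..p}"
    using e by (simp add: p_def atLeast0LessThan lessThan_Suc_atMost[symmetric])
  define d where "d = inv_into UNIV e"
  have inj: "inj e" and le: "e i \<le> p" for i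
    using ep by (auto simp: bij_betw_def)
  have d: "d (e i) = i" for i
    by (simp add: d_def inj)
  \<comment> \<open>These are inverse identifications of the two spheres. The value 0 beyond
    \<open>p\<close> is forced by the definition of \<open>nsphere\<close>.\<close>
  define \<phi> :: "(nat \<Rightarrow> real) \<Rightarrow> real ^ 'k" where "\<phi> x = (\<chi> i. x (e i))" for x
  define \<psi> :: "real ^ 'k \<Rightarrow> nat \<Rightarrow> real" where "\<psi> y n = (if n \<le> p then y $ d n else 0)" for y n
  have nrm: "(\<Sum>i\<le>p. (x i)\<^sup>2) = 1 \<longleftrightarrow> norm (\<phi> x) = 1" for x
    unfolding norm_vec_def L2_set_def \<phi>_def
    by (simp add: sum.reindex_bij_betw[OF ep, symmetric])
  have \<phi>\<psi>: "\<phi> (\<psi> y) = y" for y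
    by (simp add: \<phi>_def \<psi>_def le d)
  have cont\<phi>: "continuous_on S \<phi>" for S
    unfolding \<phi>_def by (intro continuous_on_vec_lambda continuous_on_product_coordinates
        continuous_on_subset[of UNIV] subset_UNIV)
  have \<phi>: "continuous_map (nsphere p) (top_of_set (sphere 0 1)) \<phi>"
    using cont\<phi> by (auto simp: nsphere_top_of_set nrm)
  have cont\<psi>: "continuous_on S \<psi>" for S
  proof (intro continuous_on_coordinatewise_then_product)
    show "continuous_on S (\<lambda>y. \<psi> y n)" for n
      by (cases "n \<le> p") (auto simp: \<psi>_def intro!: continuous_intros)
  qed
  have \<psi>: "continuous_map (top_of_set (sphere 0 1)) (nsphere p) \<psi>"
    using cont\<psi> by (auto simp: nsphere_top_of_set nrm \<phi>\<psi>) (simp add: \<psi>_def)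
  have "homotopic_with (\<lambda>_. True) (nsphere p) (nsphere p) (\<psi> \<circ> (id \<circ> \<phi>)) (\<psi> \<circ> (flip J \<circ> \<phi>))"
    by (intro homotopic_with_compose_continuous_map_left[OF _ \<psi>]
        homotopic_with_compose_continuous_map_right[OF assms \<phi>] TrueI)
  then have "Brouwer_degree2 p (\<psi> \<circ> (id \<circ> \<phi>)) = Brouwer_degree2 p (\<psi> \<circ> (flip J \<circ> \<phi>))"
    by (rule Brouwer_degree2_homotopic)
  moreover have inv: "e (d n) = n" if "n \<le> p" for n
    using ep that by (metis d_def atMost_iff bij_betw_imp_surj_on f_inv_into_f)
  have "Brouwer_degree2 p (\<psi> \<circ> (id \<circ> \<phi>)) = Brouwer_degree2 p id"
    by (rule Brouwer_degree2_eq) (auto simp: nsphere_top_of_set \<phi>_def \<psi>_def inv fun_eq_iff)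
  moreover have "Brouwer_degree2 p (\<psi> \<circ> (flip J \<circ> \<phi>))
      = Brouwer_degree2 p (\<lambda>x i. if i \<in> e ` J then - x i else x i)"
  proof (rule Brouwer_degree2_eq)
    have mem: "d n \<in> J \<longleftrightarrow> n \<in> e ` J" if "n \<le> p" for n
      using inv[OF that] d by (metis image_iff)
    show "(\<psi> \<circ> (flip J \<circ> \<phi>)) x = (\<lambda>i. if i \<in> e ` J then - x i else x i)"
      if "x \<in> topspace (nsphere p)" for x
      using that mem by (auto simp: nsphere_top_of_set \<phi>_def \<psi>_def flip_def inv fun_eq_iff)
  qed
  moreover have "Brouwer_degree2 p (\<lambda>x i. if i \<in> e ` J then - x i else x i) = (-1) ^ card J"
    using Brouwer_degree2_sign_change[of "e ` J" p] le
    by (auto simp: card_image[OF inj_on_subset[OF inj subset_UNIV]])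
  ultimately have "(-1) ^ card J = (1::int)"
    by simp
  then show ?thesis
    by (metis one_neq_neg_one power_minus_odd power_one)
qed

section \<open>Nonvanishing maps on the unit sphere\<close>

text \<open>This relation stands in for equality of degrees around 0. Values are only required to be
  nonzero, not of norm 1, so linear maps and increments of \<open>f\<close> can be compared without
  normalising them.\<close>

definition sphere_homotopic :: "('a::real_normed_vector \<Rightarrow> 'b::real_normed_vector) \<Rightarrow> ('a \<Rightarrow> 'b) \<Rightarrow> bool" where
  "sphere_homotopic = homotopic_with_canon (\<lambda>_. True) (sphere 0 1) (- {0})"

lemma sphere_homotopic_sym: "sphere_homotopic f g \<Longrightarrow> sphere_homotopic g f"
  unfolding sphere_homotopic_def by (rule homotopic_with_symD)

lemma sphere_homotopic_trans [trans]:
  "sphere_homotopic f g \<Longrightarrow> sphere_homotopic g h \<Longrightarrow> sphere_homotopic f h"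
  unfolding sphere_homotopic_def by (rule homotopic_with_trans)

lemma sphere_homotopic_linear:
  assumes "continuous_on (sphere 0 1) f" "continuous_on (sphere 0 1) g"
    and "\<And>u. norm u = 1 \<Longrightarrow> 0 \<notin> closed_segment (f u) (g u)"
  shows "sphere_homotopic f g"
  unfolding sphere_homotopic_def
  by (rule homotopic_with_linear) (use assms in auto)

text \<open>A Rouche-type criterion: every point of the segment from \<open>f u\<close> to
  \<open>g u\<close> is closer to \<open>f u\<close> than 0 is, so the straight-line homotopy avoids
  0.\<close>

lemma sphere_homotopic_nearby:
  assumes "continuous_on (sphere 0 1) f" "continuous_on (sphere 0 1) g"
    and "\<And>u. norm u = 1 \<Longrightarrow> norm (f u - g u) < norm (f u)"
  shows "sphere_homotopic f g"
proof (rule sphere_homotopic_linear[OF assms(1,2)])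
  fix u :: 'a
  assume "norm u = 1"
  then have *: "norm (f u - g u) < norm (f u)"
    by (rule assms(3))
  show "0 \<notin> closed_segment (f u) (g u)"
  proof
    assume "0 \<in> closed_segment (f u) (g u)"
    then have "norm (0 - f u) \<le> norm (g u - f u)"
      using segment_bound(1) by blast
    then show False
      using * by (simp add: norm_minus_commute)
  qed
qed

lemma sphere_homotopic_scaleR:
  assumes "continuous_on (sphere 0 1) f" "continuous_on (sphere 0 1) c"
    and "\<And>u. norm u = 1 \<Longrightarrow> f u \<noteq> 0" "\<And>u. norm u = 1 \<Longrightarrow> 0 < c u"
  shows "sphere_homotopic f (\<lambda>u. c u *\<^sub>R f u)"
proof (rule sphere_homotopic_linear)
  fix u :: 'a
  assume u: "norm u = 1"
  show "0 \<notin> closed_segment (f u) (c u *\<^sub>R f u)"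
  proof
    assume "0 \<in> closed_segment (f u) (c u *\<^sub>R f u)"
    then obtain t where t: "0 \<le> t" "t \<le> 1" "(1 - t + t * c u) *\<^sub>R f u = 0"
      by (auto simp: closed_segment_def algebra_simps)
    moreover have "0 < 1 - t + t * c u"
      using t assms(4)[OF u]
      by (cases "t = 0") (auto intro: add_nonneg_pos)
    ultimately show False
      using assms(3)[OF u] by simp
  qed
qed (use assms in \<open>auto intro!: continuous_intros\<close>)

lemma sphere_homotopic_compose_left:
  assumes "sphere_homotopic f g" "continuous_on (- {0}) h" "\<And>y. y \<noteq> 0 \<Longrightarrow> h y \<noteq> 0"
  shows "sphere_homotopic (h \<circ> f) (h \<circ> g)"
  using assms unfolding sphere_homotopic_def
  by (intro homotopic_with_compose_continuous_left[where Y = "- {0}"]) auto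

text \<open>As \<open>T\<close> need not preserve the unit sphere, the homotopy is precomposed with
  the normalised map \<open>n\<close> instead. Linearity of \<open>f\<close> and \<open>g\<close>
  then pulls out the positive factor \<open>1 / norm (T u)\<close>, which a rescaling homotopy
  removes.\<close>

lemma sphere_homotopic_compose_linear_right:
  fixes T :: "'a::euclidean_space \<Rightarrow> 'a" and f g :: "'a \<Rightarrow> 'b::euclidean_space"
  assumes "sphere_homotopic f g" and f: "linear f" "inj f" and g: "linear g" "inj g" and T: "linear T" "inj T"
  shows "sphere_homotopic (f \<circ> T) (g \<circ> T)"
proof -
  define n where "n = (\<lambda>u. (1 / norm (T u)) *\<^sub>R T u)"
  have T0: "T u \<noteq> 0" if "norm u = 1" for u
    using T that by (metis linear_injective_0 norm_zero zero_neq_one)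
  have contT: "continuous_on S T" for S
    using T(1) by (rule linear_continuous_on_compose[OF continuous_on_id])
  have contn: "continuous_on (sphere 0 1) n"
    unfolding n_def using T0 by (intro continuous_intros contT) auto
  have "n \<in> sphere 0 1 \<rightarrow> sphere 0 1"
    using T0 by (auto simp: n_def)
  with contn have "sphere_homotopic (f \<circ> n) (g \<circ> n)"
    using assms(1) unfolding sphere_homotopic_def
    by (intro homotopic_with_compose_continuous_right) auto
  moreover have "sphere_homotopic (h \<circ> T) (h \<circ> n)" if h: "linear h" "inj h" for h :: "'a \<Rightarrow> 'b"
  proof -
    have "h \<circ> n = (\<lambda>u. (1 / norm (T u)) *\<^sub>R (h \<circ> T) u)"
      by (auto simp: n_def linear_scale[OF h(1)])
    moreover have "sphere_homotopic (h \<circ> T) (\<lambda>u. (1 / norm (T u)) *\<^sub>R (h \<circ> T) u)"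
    proof (rule sphere_homotopic_scaleR)
      show "continuous_on (sphere 0 1) (h \<circ> T)"
        using linear_compose[OF T(1) h(1)] by (rule linear_continuous_on_compose[OF continuous_on_id])
      show "continuous_on (sphere 0 1) (\<lambda>u. 1 / norm (T u))"
        using T0 by (intro continuous_intros contT) auto
      show "(h \<circ> T) u \<noteq> 0" "0 < 1 / norm (T u)" if "norm u = 1" for u
        using T0[OF that] h linear_injective_0 by auto
    qed
    ultimately show ?thesis
      by simp
  qed
  ultimately show ?thesis
    using f g sphere_homotopic_trans sphere_homotopic_sym by meson
qed

text \<open>Radial projection retracts the punctured space onto the sphere and fixes the values of
  both maps there, since \<open>flip J\<close> preserves the norm.\<close>

lemma even_card_if_flip_sphere_homotopic_id:
  assumes "sphere_homotopic id (flip J)"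
  shows "even (card J)"
proof (rule even_card_if_flip_homotopic_id)
  define n :: "real ^ 'a \<Rightarrow> real ^ 'a" where "n y = (1 / norm y) *\<^sub>R y" for y
  have n1: "n y = y" if "norm y = 1" for y
    by (simp add: n_def that)
  have fl: "norm (flip J y) = norm y" for y
    unfolding norm_vec_def flip_def by (rule arg_cong[where f = "\<lambda>v. L2_set v UNIV"]) auto
  have "homotopic_with_canon (\<lambda>_. True) (sphere 0 1) (sphere 0 1) (n \<circ> id) (n \<circ> flip J)"
  proof (rule homotopic_with_compose_continuous_left)
    show "homotopic_with_canon (\<lambda>_. True) (sphere 0 1) (- {0}) id (flip J)"
      using assms by (simp add: sphere_homotopic_def)
  qed (auto simp: n_def intro!: continuous_intros)
  then show "homotopic_with_canon (\<lambda>_. True) (sphere 0 1) (sphere 0 1) id (flip J)"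
    by (rule homotopic_with_eq) (auto simp: n1 fl)
qed

section \<open>Linear families crossing a singular operator\<close>

text \<open>A basis of \<open>K\<close> is extended to the whole space and indexed by
  \<open>'k\<close>; \<open>P\<close> sends the standard basis to it. In these coordinates a sign
  change along \<open>K\<close> becomes a flip of the coordinates in \<open>J\<close>.\<close>

lemma subspace_coordinates:
  fixes K :: "(real ^ 'k) set"
  assumes "subspace K"
  obtains P :: "real ^ 'k \<Rightarrow> real ^ 'k" and J
    where "linear P" "inj P" "card J = dim K" "P ` {y. \<forall>i. i \<notin> J \<longrightarrow> y $ i = 0} = K"
proof -
  obtain B0 where B0: "B0 \<subseteq> K" "independent B0" "K \<subseteq> span B0" "card B0 = dim K"
    using basis_exists by blast
  obtain B1 where B1: "B0 \<subseteq> B1" "independent B1" "UNIV \<subseteq> span B1"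
    using maximal_independent_subset_extend[of B0 UNIV] B0(2) by auto
  then have "span B1 = UNIV" "finite B1"
    by (auto simp: independent_bound)
  then have "card B1 = CARD('k)"
    using B1(2) dim_eq_card[of B1 UNIV] by simp
  then obtain c where c: "bij_betw c (UNIV::'k set) B1"
    using finite_same_card_bij[of "UNIV::'k set" B1] \<open>finite B1\<close> by auto
  define J where "J = c -` B0"
  define P where "P y = (\<Sum>i\<in>UNIV. y $ i *\<^sub>R c i)" for y :: "real ^ 'k"
  have lin: "linear P"
    by (rule linearI) (simp_all add: P_def scaleR_add_left sum.distrib scaleR_sum_right)
  have Pax: "P (axis i 1) = c i" for i
    by (simp add: P_def axis_def if_distrib[where f = "\<lambda>x. x *\<^sub>R _"] cong: if_cong)
  have "B1 \<subseteq> range P"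
    using c Pax by (metis bij_betw_imp_surj_on image_subset_iff rangeI)
  then have "surj P"
    using B1(3) span_minimal[of B1 "range P"] linear_subspace_image[OF lin subspace_UNIV] by auto
  then have inj: "inj P"
    using lin linear_surjective_imp_injective by blast
  have cJ: "c ` J = B0"
    using B1(1) c by (auto simp: J_def bij_betw_def)
  have "card J = dim K"
    using cJ B0(4) card_image[of c J] c by (metis bij_betw_def inj_on_subset subset_UNIV)
  moreover have "P ` {y. \<forall>i. i \<notin> J \<longrightarrow> y $ i = 0} = K"
  proof
    show "P ` {y. \<forall>i. i \<notin> J \<longrightarrow> y $ i = 0} \<subseteq> K"
    proof clarify
      fix y :: "real ^ 'k"
      assume y: "\<forall>i. i \<notin> J \<longrightarrow> y $ i = 0"
      have "y $ i *\<^sub>R c i \<in> K" for i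
        using y B0(1) assms by (cases "i \<in> J") (auto simp: J_def subspace_scale subspace_0)
      then show "P y \<in> K"
        unfolding P_def by (intro subspace_sum[OF assms])
    qed
    have "subspace (P ` {y. \<forall>i. i \<notin> J \<longrightarrow> y $ i = 0})"
      by (intro linear_subspace_image[OF lin]) (simp add: subspace_def)
    moreover have "B0 \<subseteq> P ` {y. \<forall>i. i \<notin> J \<longrightarrow> y $ i = 0}"
    proof
      fix b assume "b \<in> B0"
      then obtain i where "i \<in> J" "b = P (axis i 1)"
        using cJ Pax by auto
      then show "b \<in> P ` {y. \<forall>i. i \<notin> J \<longrightarrow> y $ i = 0}"
        by (auto simp: axis_def)
    qed
    ultimately show "K \<subseteq> P ` {y. \<forall>i. i \<notin> J \<longrightarrow> y $ i = 0}"
      using B0(3) span_minimal by blast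
  qed
  ultimately show ?thesis
    using that lin inj by blast
qed

section \<open>Uniform estimates for convergent families of linear maps\<close>

text \<open>In finite dimension the errors on the finitely many basis vectors control the operator
  norm of the difference.\<close>

lemma linear_pointwise_limit_uniform:
  fixes X :: "'i \<Rightarrow> 'a::euclidean_space \<Rightarrow> 'b::real_normed_vector"
  assumes X: "\<And>t. linear (X t)" and C: "linear C" and e: "0 < e"
    and lim: "\<And>y. filterlim (\<lambda>t. X t y) (nhds (C y)) F"
  shows "\<forall>\<^sub>F t in F. \<forall>u. norm (C u - X t u) \<le> e * norm u"
proof -
  have "filterlim (\<lambda>t. \<Sum>b\<in>Basis. norm (C b - X t b)) (nhds (\<Sum>b\<in>(Basis::'a set). norm (C b - C b))) F"
    by (intro tendsto_intros lim)
  then have "\<forall>\<^sub>F t in F. (\<Sum>b\<in>Basis. norm (C b - X t b)) < e"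
    using e by (intro order_tendstoD(2)) auto
  then show ?thesis
  proof (eventually_elim, intro allI)
    fix t u
    assume t: "(\<Sum>b\<in>Basis. norm (C b - X t b)) < e"
    interpret D: linear "\<lambda>y. C y - X t y"
      using C(1) X by (rule linear_compose_sub)
    have "C u - X t u = (\<Sum>b\<in>Basis. (u \<bullet> b) *\<^sub>R (C b - X t b))"
      using D.sum[of "\<lambda>b. (u \<bullet> b) *\<^sub>R b" Basis] by (simp add: euclidean_representation D.scaleR)
    also have "norm \<dots> \<le> (\<Sum>b\<in>Basis. norm (C b - X t b) * norm u)"
    proof (rule order_trans[OF norm_sum sum_mono])
      fix b :: 'a assume "b \<in> Basis"
      then show "norm ((u \<bullet> b) *\<^sub>R (C b - X t b)) \<le> norm (C b - X t b) * norm u"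
        using mult_right_mono[OF Basis_le_norm[of b u], of "norm (C b - X t b)"] by (simp add: mult.commute)
    qed
    also have "\<dots> \<le> e * norm u"
      using t by (simp add: sum_distrib_right[symmetric] mult_right_mono)
    finally show "norm (C u - X t u) \<le> e * norm u" .
  qed
qed

text \<open>An injective \<open>C\<close> has a positive lower bound, and \<open>e\<close> is half
  of it: one half absorbs the error, the other half is left as a lower bound for
  \<open>X t\<close>.\<close>

lemma linear_pointwise_limit_bounded_below:
  fixes X :: "'i \<Rightarrow> 'a::euclidean_space \<Rightarrow> 'b::euclidean_space"
  assumes X: "\<And>t. linear (X t)" and C: "linear C" "inj C"
    and lim: "\<And>y. filterlim (\<lambda>t. X t y) (nhds (C y)) F"
  obtains e where "0 < e" "\<forall>\<^sub>F t in F. \<forall>u. norm (C u - X t u) \<le> e * norm u \<and> e * norm u \<le> norm (X t u)"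
    "\<And>u. 2 * e * norm u \<le> norm (C u)"
proof -
  obtain e where e: "0 < e" "\<And>y. e * norm y \<le> norm (C y)"
    using linear_inj_bounded_below_pos[OF C] by metis
  then have "\<forall>\<^sub>F t in F. \<forall>u. norm (C u - X t u) \<le> (e / 2) * norm u"
    by (intro linear_pointwise_limit_uniform X C(1) lim) auto
  then have "\<forall>\<^sub>F t in F. \<forall>u. norm (C u - X t u) \<le> (e / 2) * norm u \<and> (e / 2) * norm u \<le> norm (X t u)"
  proof eventually_elim
    case (elim t)
    have "(e / 2) * norm u \<le> norm (X t u)" for u
      using elim[rule_format, of u] e(2)[of u] norm_triangle_ineq2[of "C u" "X t u"]
      by (simp add: algebra_simps)
    then show ?case
      using elim by blast
  qed
  then show thesis
    using e by (intro that[of "e / 2"]) auto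
qed

lemma has_vector_derivative_quotient:
  assumes "(f has_vector_derivative D) (at 0)"
  shows "(\<lambda>t. (f t - f 0) /\<^sub>R t) \<midarrow>0\<rightarrow> D"
proof -
  have "(\<lambda>t. norm (f t - f 0 - t *\<^sub>R D) / norm t) \<midarrow>0\<rightarrow> 0"
    using assms unfolding has_vector_derivative_def has_derivative_at by auto
  moreover have "norm (f t - f 0 - t *\<^sub>R D) / norm t = norm ((f t - f 0) /\<^sub>R t - D)" if "t \<noteq> 0" for t
  proof -
    have "f t - f 0 - t *\<^sub>R D = t *\<^sub>R ((f t - f 0) /\<^sub>R t - D)"
      using that by (simp add: algebra_simps)
    then show ?thesis
      using that by simp
  qed
  ultimately have "(\<lambda>t. norm ((f t - f 0) /\<^sub>R t - D)) \<midarrow>0\<rightarrow> 0"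
    by (simp cong: LIM_cong)
  then show ?thesis
    by (rule LIM_zero_cancel[OF tendsto_norm_zero_cancel])
qed

text \<open>After rescaling, both \<open>A t\<close> and \<open>A (- t)\<close> are compared with
  the same injective limit \<open>C\<close>. The comparison for \<open>- t\<close> differs by a flip
  of the kernel coordinates, and their odd number makes a homotopy impossible.\<close>

lemma linear_path_not_sphere_homotopic:
  fixes A :: "real \<Rightarrow> real ^ 'k \<Rightarrow> real ^ 'k"
  assumes lin: "\<And>t. linear (A t)"
    and der: "\<And>u. ((\<lambda>t. A t u) has_vector_derivative B u) (at 0)"
    and transversal: "\<And>u. A 0 u = 0 \<Longrightarrow> u \<noteq> 0 \<Longrightarrow> B u \<notin> range (A 0)"
    and odd: "odd (dim {u. A 0 u = 0})"
  shows "\<exists>\<delta>>0. \<forall>t. 0 < t \<and> t < \<delta> \<longrightarrow> inj (A t) \<and> inj (A (- t)) \<and> \<not> sphere_homotopic (A t) (A (- t))"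
proof -
  have linB: "linear B"
  proof
    show "B (u + v) = B u + B v" for u v
      using has_vector_derivative_add[OF der[of u] der[of v]] der[of "u + v"]
      by (simp add: linear_add[OF lin] vector_derivative_unique_at)
    show "B (c *\<^sub>R u) = c *\<^sub>R B u" for c u
      using has_vector_derivative_scaleR[OF DERIV_const der[of u], of c] der[of "c *\<^sub>R u"]
      by (simp add: linear_scale[OF lin] vector_derivative_unique_at)
  qed
  have "subspace {u. A 0 u = 0}"
    by (rule linear_subspace_kernel[OF lin])
  then obtain P :: "real ^ 'k \<Rightarrow> real ^ 'k" and J where P: "linear P" "inj P"
    and J: "card J = dim {u. A 0 u = 0}" "P ` {y. \<forall>i. i \<notin> J \<longrightarrow> y $ i = 0} = {u. A 0 u = 0}"
    by (rule subspace_coordinates)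
  \<comment> \<open>In the coordinates given by \<open>P\<close>, \<open>\<pi>\<close> projects onto
    the kernel of \<open>A 0\<close> and \<open>D s\<close> multiplies the kernel part by
    \<open>s\<close>. So \<open>X t\<close> divides the kernel directions by \<open>t\<close>, and
    its limit \<open>C\<close> is \<open>A 0\<close> on the complement and the derivative
    \<open>B\<close> on the kernel. The limit is punctured at 0, where \<open>1 / t\<close> has its
    default value 0.\<close>
  define \<pi> where "\<pi> y = (\<chi> i. if i \<in> J then y $ i else 0)" for y :: "real ^ 'k"
  define D where "D s y = y + (s - 1) *\<^sub>R \<pi> y" for s and y :: "real ^ 'k"
  define C where "C y = A 0 (P (y - \<pi> y)) + B (P (\<pi> y))" for y
  define X where "X t = A t \<circ> P \<circ> D (1 / t)" for t
  have lin\<pi>: "linear \<pi>"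
    by (rule linearI) (auto simp: \<pi>_def vec_eq_iff)
  have \<pi>\<pi>: "\<pi> (\<pi> y) = \<pi> y" for y
    by (auto simp: \<pi>_def vec_eq_iff)
  have linD: "linear (D s)" for s
    unfolding D_def by (intro linear_compose_add linear_compose_scale_right lin\<pi> linear_id[unfolded id_def])
  have DD: "D r (D s y) = D (r * s) y" for r s y
    by (auto simp: D_def \<pi>_def vec_eq_iff algebra_simps)
  have D1: "D 1 y = y" for y
    by (simp add: D_def)
  have Dm1: "D (-1) = flip J"
    by (auto simp: fun_eq_iff D_def \<pi>_def flip_def vec_eq_iff)
  have injD: "inj (D s)" if "s \<noteq> 0" for s
    by (rule inj_on_inverseI[where g = "D (1/s)"]) (simp add: DD D1 that)
  have linX: "linear (X t)" for t
    unfolding X_def by (intro linear_compose lin P linD)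
  have PK: "A 0 (P (\<pi> y)) = 0" for y
    using J(2) by (auto simp: \<pi>_def)
  have linC: "linear C"
    unfolding C_def
    by (intro linear_compose_add linear_compose[OF _ lin, unfolded o_def] linear_compose[OF _ linB, unfolded o_def]
        linear_compose[OF _ P(1), unfolded o_def] linear_compose_sub lin\<pi> linear_id[unfolded id_def])
  \<comment> \<open>If \<open>C y = 0\<close>, then \<open>B\<close> maps the kernel part of
    \<open>y\<close> into the range of \<open>A 0\<close>, so transversality makes that part vanish.
    What remains is killed by \<open>A 0\<close>, hence has only kernel coordinates, and these are
    zero.\<close>
  have "y = 0" if "C y = 0" for y
  proof -
    have "B (P (\<pi> y)) = A 0 (- P (y - \<pi> y))"
      using that unfolding C_def by (simp add: linear_neg[OF lin] eq_neg_iff_add_eq_0 add.commute)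
    then have "P (\<pi> y) = 0"
      using transversal[OF PK] by blast
    then have "\<pi> y = 0"
      using P linear_injective_0 by blast
    then have "A 0 (P y) = 0"
      using that by (simp add: C_def linear_0[OF P(1)] linear_0[OF linB])
    then have "P y \<in> P ` {y. \<forall>i. i \<notin> J \<longrightarrow> y $ i = 0}"
      using J(2) by blast
    then have "\<forall>i. i \<notin> J \<longrightarrow> y $ i = 0"
      using P(2) by (simp add: inj_image_mem_iff)
    then show "y = 0"
      using \<open>\<pi> y = 0\<close> unfolding vec_eq_iff \<pi>_def by (auto split: if_splits)
  qed
  then have injC: "inj C"
    using linC linear_injective_0 by blast
  have "(\<lambda>t. X t y) \<midarrow>0\<rightarrow> C y" for y
  proof -
    have cont: "(\<lambda>t. A t u) \<midarrow>0\<rightarrow> A 0 u" for u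
      using has_vector_derivative_continuous[OF der] by (simp add: isCont_def)
    \<comment> \<open>The subtracted term is zero by \<open>PK\<close>, so the difference quotient
      is exactly the rescaled kernel part of \<open>X t y\<close>.\<close>
    have "(\<lambda>t. (A t (P (\<pi> y)) - A 0 (P (\<pi> y))) /\<^sub>R t) \<midarrow>0\<rightarrow> B (P (\<pi> y))"
      by (rule has_vector_derivative_quotient[OF der])
    then have "(\<lambda>t. A t (P (y - \<pi> y)) + A t (P (\<pi> y)) /\<^sub>R t) \<midarrow>0\<rightarrow> C y"
      unfolding C_def by (intro tendsto_add cont) (simp add: PK)
    moreover have "X t y = A t (P (y - \<pi> y)) + A t (P (\<pi> y)) /\<^sub>R t" for t
    proof -
      have "D (1 / t) y = (y - \<pi> y) + (1 / t) *\<^sub>R \<pi> y"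
        by (simp add: D_def algebra_simps)
      then show ?thesis
        by (simp add: X_def linear_add[OF P(1)] linear_scale[OF P(1)] linear_add[OF lin]
            linear_scale[OF lin] divide_inverse)
    qed
    ultimately show ?thesis
      by simp
  qed
  from linear_pointwise_limit_bounded_below[OF linX linC injC this]
  obtain e where e: "0 < e" "\<And>u. 2 * e * norm u \<le> norm (C u)"
    and ev: "\<forall>\<^sub>F t in at 0. \<forall>u. norm (C u - X t u) \<le> e * norm u \<and> e * norm u \<le> norm (X t u)"
    by blast
  from ev obtain \<delta> where "0 < \<delta>"
    and \<delta>: "\<And>t u. t \<noteq> 0 \<Longrightarrow> \<bar>t\<bar> < \<delta> \<Longrightarrow> norm (C u - X t u) \<le> e * norm u"
      "\<And>t u. t \<noteq> 0 \<Longrightarrow> \<bar>t\<bar> < \<delta> \<Longrightarrow> e * norm u \<le> norm (X t u)"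
    unfolding eventually_at by (auto simp: dist_real_def)
  have cont: "continuous_on S h" if "linear h" for S and h :: "real ^ 'k \<Rightarrow> real ^ 'k"
    using linear_continuous_on_compose[OF continuous_on_id that] .
  have CX: "sphere_homotopic C (X t)" if "t \<noteq> 0" "\<bar>t\<bar> < \<delta>" for t
  proof (rule sphere_homotopic_nearby[OF cont[OF linC] cont[OF linX]])
    show "norm (C u - X t u) < norm (C u)" if "norm u = 1" for u
      using \<delta>(1)[OF \<open>t \<noteq> 0\<close> \<open>\<bar>t\<bar> < \<delta>\<close>, of u] e(1) e(2)[of u] that by simp
  qed
  have injX: "inj (X t)" if t: "t \<noteq> 0" "\<bar>t\<bar> < \<delta>" for t
  proof -
    have "u = 0" if "X t u = 0" for u
      using \<delta>(2)[OF t, of u] that e(1) by (simp add: mult_le_0_iff)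
    then show ?thesis
      using linX linear_injective_0 by blast
  qed
  have injA: "inj (A t)" if t: "t \<noteq> 0" "\<bar>t\<bar> < \<delta>" for t
  proof -
    have "surj (X t)"
      using injX[OF t] linX linear_injective_imp_surjective by blast
    then have "surj (A t)"
      unfolding X_def image_comp[symmetric] by blast
    then show ?thesis
      using lin linear_surjective_imp_injective by blast
  qed
  have "\<not> sphere_homotopic (A t) (A (- t))" if t: "0 < t" "t < \<delta>" for t
  proof
    have t': "t \<noteq> 0" "\<bar>t\<bar> < \<delta>" "- t \<noteq> 0" "\<bar>- t\<bar> < \<delta>"
      using t by auto
    assume "sphere_homotopic (A t) (A (- t))"
    then have "sphere_homotopic (A t \<circ> (P \<circ> D (1 / t))) (A (- t) \<circ> (P \<circ> D (1 / t)))"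
      using lin injA t' P linD injD[of "1 / t"]
      by (intro sphere_homotopic_compose_linear_right linear_compose inj_compose) auto
    moreover have "A t \<circ> (P \<circ> D (1 / t)) = X t"
      by (simp add: X_def o_assoc)
    \<comment> \<open>Dividing the kernel part by \<open>t\<close> is dividing it by
      \<open>- t\<close> after a change of sign: \<open>D (1 / t)\<close> is
      \<open>D (1 / (- t))\<close> after \<open>D (-1)\<close>, and \<open>D (-1)\<close> is the
      flip.\<close>
    moreover have "A (- t) \<circ> (P \<circ> D (1 / t)) = X (- t) \<circ> D (-1)"
      by (auto simp: X_def fun_eq_iff DD)
    ultimately have "sphere_homotopic (X t) (X (- t) \<circ> D (-1))"
      by simp
    moreover have "sphere_homotopic (C \<circ> D (-1)) (X (- t) \<circ> D (-1))"
      using CX t' linC injC linX injX linD injD[of "-1"] by (intro sphere_homotopic_compose_linear_right) auto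
    ultimately have *: "sphere_homotopic C (C \<circ> flip J)"
      using CX[OF t'(1,2)] sphere_homotopic_sym sphere_homotopic_trans unfolding Dm1 by blast
    \<comment> \<open>Composing with the inverse of \<open>C\<close> on the left reduces the
      homotopy to one between the identity and \<open>flip J\<close>.\<close>
    obtain C' where C': "linear C'" "C' \<circ> C = id"
      using linear_injective_left_inverse[OF linC injC] by blast
    then have "C \<circ> C' = id"
      using linC linear_inverse_left by blast
    then have "C' y \<noteq> 0" if "y \<noteq> 0" for y
      using that linear_0[OF linC] by (metis comp_apply id_apply)
    then have "sphere_homotopic (C' \<circ> C) (C' \<circ> (C \<circ> flip J))"
      by (rule sphere_homotopic_compose_left[OF * cont[OF C'(1)]])
    then have "sphere_homotopic id (flip J)"
      using C'(2) by (simp add: o_assoc)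
    then show False
      using even_card_if_flip_sphere_homotopic_id odd J(1) by metis
  qed
  then show ?thesis
    using \<open>0 < \<delta>\<close> injA by (intro exI[of _ \<delta>]) auto
qed

section \<open>Zero sets of continuously differentiable maps\<close>

text \<open>Solutions of linear equations depend continuously on the data: the uniform lower bound
  for \<open>X t\<close> turns convergence of \<open>X t (c t)\<close> into convergence of
  \<open>c t\<close>. This serves to show that the derivative of an implicit function is
  continuous.\<close>

lemma tendsto_linear_equation:
  fixes X :: "'i \<Rightarrow> 'a::euclidean_space \<Rightarrow> 'b::euclidean_space"
  assumes X: "\<And>t. linear (X t)" and C: "linear C" "inj C"
    and lim: "\<And>y. filterlim (\<lambda>t. X t y) (nhds (C y)) F"
    and b: "filterlim (\<lambda>t. X t (c t)) (nhds (C d)) F"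
  shows "filterlim c (nhds d) F"
proof -
  obtain e where e: "0 < e"
    and ev: "\<forall>\<^sub>F t in F. \<forall>u. norm (C u - X t u) \<le> e * norm u \<and> e * norm u \<le> norm (X t u)"
    by (rule linear_pointwise_limit_bounded_below[OF X C lim])
  have "filterlim (\<lambda>t. norm (X t (c t) - X t d) / e) (nhds (norm (C d - C d) / e)) F"
    by (intro tendsto_intros b lim) (use e in simp)
  then have "filterlim (\<lambda>t. norm (X t (c t) - X t d) / e) (nhds 0) F"
    by simp
  moreover have "\<forall>\<^sub>F t in F. norm (c t - d) \<le> norm (X t (c t) - X t d) / e"
    using ev
  proof eventually_elim
    case (elim t)
    then have "e * norm (c t - d) \<le> norm (X t (c t) - X t d)"
      unfolding linear_diff[OF X, symmetric] by blast
    then show ?case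
      using e by (simp add: field_simps)
  qed
  ultimately have "filterlim (\<lambda>t. c t - d) (nhds 0) F"
    by (rule Lim_null_comparison[rotated])
  then show ?thesis
    by (rule LIM_zero_cancel)
qed

text \<open>The inverse function theorem is applied to \<open>G (x, q) = (x, H (x, q))\<close>,
  whose differential at \<open>(a, b)\<close> is injective because the partial differential in
  \<open>q\<close> is.\<close>

lemma implicit_function:
  fixes H :: "'a::euclidean_space \<times> 'b::euclidean_space \<Rightarrow> 'b"
  assumes der: "\<And>z. (H has_derivative H' z) (at z)"
    and cont: "\<And>v. continuous_on UNIV (\<lambda>z. H' z v)"
    and zero: "H (a, b) = 0" and inj: "inj (\<lambda>q. H' (a, b) (0, q))"
  obtains U V g g' where "open U" "(a, b) \<in> U" "open V" "a \<in> V" "g a = b"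
    "\<And>x. x \<in> V \<Longrightarrow> (x, g x) \<in> U" "\<And>x. x \<in> V \<Longrightarrow> H (x, g x) = 0"
    "\<And>x q. (x, q) \<in> U \<Longrightarrow> H (x, q) = 0 \<Longrightarrow> x \<in> V \<and> q = g x"
    "\<And>x. x \<in> V \<Longrightarrow> (g has_derivative g' x) (at x)"
    "\<And>x v. x \<in> V \<Longrightarrow> H' (x, g x) (v, g' x v) = 0"
    "\<And>v. continuous_on V (\<lambda>x. g' x v)"
proof -
  define G where "G z = (fst z, H z)" for z
  define G' where "G' z = Blinfun (\<lambda>w. (fst w, H' z w))" for z
  have linH: "linear (H' z)" for z
    using der has_derivative_linear by blast
  have derG: "(G has_derivative (\<lambda>w. (fst w, H' z w))) (at z)" for z
    unfolding G_def by (intro derivative_intros der)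
  then have G': "blinfun_apply (G' z) = (\<lambda>w. (fst w, H' z w))" for z
    unfolding G'_def by (intro Blinfun_inverse CollectI has_derivative_bounded_linear[OF derG])
  have contG': "continuous_on UNIV G'"
    by (rule continuous_on_blinfun_componentwise) (auto simp: G' intro!: continuous_intros cont)
  have linG: "linear (\<lambda>w. (fst w, H' z w))" for z
    using derG has_derivative_linear by blast
  have "w = 0" if "(fst w, H' (a, b) w) = 0" for w
  proof -
    have "H' (a, b) (0, snd w) = H' (a, b) (0, 0)"
      using that linear_0[OF linH] by (cases w) (auto simp: zero_prod_def)
    then show ?thesis
      using injD[OF inj] that by (metis fst_conv prod.collapse zero_prod_def)
  qed
  then have "inj (\<lambda>w. (fst w, H' (a, b) w))"
    using linear_injective_0[OF linG] by blast
  then obtain h where h: "linear h" "h \<circ> (\<lambda>w. (fst w, H' (a, b) w)) = id"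
    using linear_injective_left_inverse[OF linG] by blast
  have invG': "Blinfun h o\<^sub>L G' (a, b) = id_blinfun"
    using h by (intro blinfun_eqI) (auto simp: Blinfun_inverse linear_conv_bounded_linear[symmetric] G' fun_eq_iff)
  have derG': "(G has_derivative blinfun_apply (G' z)) (at z)" for z
    using derG by (simp add: G')
  obtain U W k k' where U: "open U" "U \<subseteq> UNIV" "(a, b) \<in> U" and W: "open W" "G (a, b) \<in> W"
    and hom: "homeomorphism U W G k" and derk: "\<And>y. y \<in> W \<Longrightarrow> (k has_derivative k' y) (at y)"
    and "\<And>y. y \<in> W \<Longrightarrow> k' y = inv_into UNIV (blinfun_apply (G' (k y)))"
    and bij: "\<And>y. y \<in> W \<Longrightarrow> bij (blinfun_apply (G' (k y)))"
    by (rule inverse_function_theorem[OF open_UNIV derG' contG' UNIV_I invG']) (rule that)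
  \<comment> \<open>Zeros of \<open>H\<close> in \<open>U\<close> are the points that
    \<open>G\<close> sends to some \<open>(x, 0)\<close>, so the local inverse \<open>k\<close> on
    this slice of \<open>W\<close> parametrises them.\<close>
  define V where "V = (\<lambda>x. (x, 0)) -` W"
  define g where "g x = snd (k (x, 0))" for x
  define g' where "g' x v = snd (k' (x, 0) (v, 0))" for x v
  have V: "open V" "a \<in> V"
    using W zero by (auto simp: V_def G_def intro!: open_vimage continuous_intros)
  have k: "k (x, 0) \<in> U \<and> G (k (x, 0)) = (x, 0)" if "x \<in> V" for x
    using hom that unfolding V_def homeomorphism_def by auto
  have kg: "k (x, 0) = (x, g x)" if "x \<in> V" for x
    using k[OF that] by (auto simp: G_def g_def prod_eq_iff)
  have zeros: "x \<in> V \<and> q = g x" if "(x, q) \<in> U" "H (x, q) = 0" for x q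
  proof -
    have "G (x, q) \<in> W" "k (G (x, q)) = (x, q)"
      using hom that unfolding homeomorphism_def by auto
    then show ?thesis
      using that by (auto simp: G_def V_def g_def)
  qed
  have Hg: "H (x, g x) = 0" if "x \<in> V" for x
    using k[OF that] kg[OF that] by (simp add: G_def)
  have derg: "(g has_derivative g' x) (at x)" if "x \<in> V" for x
  proof -
    have "((\<lambda>x. k (x, 0)) has_derivative (\<lambda>v. k' (x, 0) (v, 0))) (at x)"
      using that by (intro has_derivative_compose[where g = k, OF _ derk] derivative_intros) (auto simp: V_def)
    then show ?thesis
      unfolding g_def g'_def by (rule has_derivative_snd)
  qed
  have Hg': "H' (x, g x) (v, g' x v) = 0" if x: "x \<in> V" for x v
  proof -
    have "((\<lambda>x. H (x, g x)) has_derivative (\<lambda>v. H' (x, g x) (v, g' x v))) (at x)"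
      by (intro has_derivative_compose[where g = H, OF _ der] derivative_intros derg x)
    moreover have "((\<lambda>x. H (x, g x)) has_derivative (\<lambda>v. 0)) (at x)"
      by (rule has_derivative_transform_within_open[OF has_derivative_const V(1) x]) (simp add: Hg)
    ultimately show ?thesis
      by (metis has_derivative_unique)
  qed
  \<comment> \<open>Differentiating \<open>H (x, g x) = 0\<close> gives a linear equation for
    \<open>g' x v\<close> with continuous coefficients. Its operator is injective at every point of
    \<open>V\<close>, not just at \<open>a\<close>, because \<open>G'\<close> is bijective at all
    points \<open>k y\<close> with \<open>y\<close> in \<open>W\<close>.\<close>
  have contg': "continuous_on V (\<lambda>x. g' x v)" for v
    unfolding continuous_on_def
  proof
    fix x assume x: "x \<in> V"
    have contg: "filterlim (\<lambda>x. (x, g x)) (nhds (x, g x)) (at x within V)"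
      using has_derivative_continuous[OF derg[OF x]]
      by (intro tendsto_intros) (simp add: continuous_at_imp_continuous_within continuous_within[symmetric])
    have lim: "filterlim (\<lambda>x. H' (x, g x) u) (nhds (H' (x, g x) u)) (at x within V)" for u
      by (rule isCont_tendsto_compose[where g = "\<lambda>z. H' z u", OF _ contg])
        (use cont continuous_on_eq_continuous_at in blast)
    have split: "H' (y, g y) (0, g' y v) = - H' (y, g y) (v, 0)" if "y \<in> V" for y
    proof -
      have "H' (y, g y) (v, g' y v) = H' (y, g y) ((v, 0) + (0, g' y v))"
        by simp
      also have "\<dots> = H' (y, g y) (v, 0) + H' (y, g y) (0, g' y v)"
        by (rule linear_add[OF linH])
      finally show ?thesis
        using Hg'[OF that] by (simp add: eq_neg_iff_add_eq_0 add.commute)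
    qed
    have lin0: "linear (\<lambda>q. H' z (0, q))" for z
      by (rule linear_compose[OF _ linH, unfolded o_def]) (simp add: linear_iff)
    have inj0: "inj (\<lambda>q. H' (x, g x) (0, q))"
    proof (rule injI)
      fix p q assume "H' (x, g x) (0, p) = H' (x, g x) (0, q)"
      then have "blinfun_apply (G' (k (x, 0))) (0, p) = blinfun_apply (G' (k (x, 0))) (0, q)"
        by (simp add: kg[OF x] G')
      moreover have "inj (blinfun_apply (G' (k (x, 0))))"
        using bij x by (simp add: V_def bij_is_inj)
      ultimately show "p = q"
        using injD by fastforce
    qed
    show "filterlim (\<lambda>x. g' x v) (nhds (g' x v)) (at x within V)"
    proof (rule tendsto_linear_equation[OF lin0 lin0 inj0 lim])
      have "filterlim (\<lambda>y. - H' (y, g y) (v, 0)) (nhds (- H' (x, g x) (v, 0))) (at x within V)"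
        by (intro tendsto_intros lim)
      then show "filterlim (\<lambda>y. H' (y, g y) (0, g' y v)) (nhds (H' (x, g x) (0, g' x v))) (at x within V)"
        unfolding split[OF x]
        by (rule Lim_transform_eventually) (simp add: eventually_at_filter split)
    qed
  qed
  have gab: "g a = b"
    using zeros[OF U(3) zero] by simp
  have gU: "(x, g x) \<in> U" if "x \<in> V" for x
    using k[OF that] kg[OF that] by simp
  show thesis
    by (rule that[OF U(1,3) V gab gU Hg zeros derg Hg' contg'])
qed

text \<open>With \<open>N\<close> a right inverse of \<open>f' z\<close>, the equation is restricted
  to the slice \<open>z + t w + N q\<close>. There the partial differential in \<open>q\<close> at
  the origin is the identity, so \<open>q\<close> can be solved for as a function of
  \<open>t\<close>.\<close>

lemma curve_in_zero_set:
  fixes f :: "'a::euclidean_space \<Rightarrow> 'b::euclidean_space"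
  assumes der: "\<And>z. (f has_derivative f' z) (at z)"
    and cont: "\<And>v. continuous_on UNIV (\<lambda>z. f' z v)"
    and zero: "f z = 0" and surj: "surj (f' z)" and w: "f' z w = 0"
  obtains \<gamma> :: "real \<Rightarrow> 'a" and e where "0 < e" "\<gamma> 0 = z" "(\<gamma> has_vector_derivative w) (at 0)"
    "continuous_on {-e<..<e} \<gamma>" "\<And>t. t \<in> {-e<..<e} \<Longrightarrow> f (\<gamma> t) = 0"
proof -
  have linf: "linear (f' z)" for z
    using der has_derivative_linear by blast
  obtain N where N: "linear N" "f' z \<circ> N = id"
    using linear_surjective_right_inverse[OF linf surj] by blast
  then have fN: "f' z (N q) = q" for q
    by (metis comp_apply id_apply)
  define c where "c y = z + fst y *\<^sub>R w + N (snd y)" for y :: "real \<times> 'b"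
  have derN: "((\<lambda>x. N (h x)) has_derivative (\<lambda>v. N (h' v))) F" if "(h has_derivative h') F"
    for h :: "'d::euclidean_space \<Rightarrow> 'b" and h' F
    using that N(1) linear_conv_bounded_linear bounded_linear.has_derivative by blast
  have derc: "(c has_derivative (\<lambda>v. fst v *\<^sub>R w + N (snd v))) (at y)" for y
  proof -
    have "(c has_derivative (\<lambda>v. 0 + fst v *\<^sub>R w + N (snd v))) (at y)"
      unfolding c_def by (intro has_derivative_add has_derivative_const has_derivative_scaleR_left
          has_derivative_ident has_derivative_fst has_derivative_snd derN)
    then show ?thesis
      by simp
  qed
  have contc: "continuous_on UNIV c"
    using has_derivative_continuous[OF derc] by (intro continuous_at_imp_continuous_on) auto
  have derH: "(f \<circ> c has_derivative (\<lambda>v. f' (c y) (fst v *\<^sub>R w + N (snd v)))) (at y)" for y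
    unfolding o_def by (rule has_derivative_compose[OF derc der])
  have contH: "continuous_on UNIV (\<lambda>y. f' (c y) (fst v *\<^sub>R w + N (snd v)))" for v
    by (rule continuous_on_compose2[OF cont contc]) auto
  have c0: "c (0, 0) = z"
    by (simp add: c_def linear_0[OF N(1)])
  have inj: "inj (\<lambda>q. f' (c (0, 0)) (fst (0::real, q) *\<^sub>R w + N (snd (0::real, q))))"
    by (simp add: c0 fN)
  have fc0: "(f \<circ> c) (0, 0) = 0"
    by (simp add: c0 zero)
  show thesis
  proof (rule implicit_function[OF derH contH fc0 inj])
    fix V and g :: "real \<Rightarrow> 'b" and g'
    assume V: "open V" "0 \<in> V" and g0: "g 0 = 0"
      and fc: "\<And>x. x \<in> V \<Longrightarrow> (f \<circ> c) (x, g x) = 0"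
      and derg: "\<And>x. x \<in> V \<Longrightarrow> (g has_derivative g' x) (at x)"
      and fc': "\<And>x v. x \<in> V \<Longrightarrow> f' (c (x, g x)) (fst (v, g' x v) *\<^sub>R w + N (snd (v, g' x v))) = 0"
    obtain e where "0 < e" "ball 0 e \<subseteq> V"
      using V open_contains_ball by blast
    then have e: "0 < e" "{-e<..<e} \<subseteq> V"
      by (auto simp: ball_eq_greaterThanLessThan)
    define \<gamma> where "\<gamma> t = z + t *\<^sub>R w + N (g t)" for t
    have der\<gamma>: "(\<gamma> has_derivative (\<lambda>s. s *\<^sub>R w + N (g' t s))) (at t)" if "t \<in> V" for t
      proof -
      have "(\<gamma> has_derivative (\<lambda>s. 0 + s *\<^sub>R w + N (g' t s))) (at t)"
        unfolding \<gamma>_def by (intro has_derivative_add has_derivative_const has_derivative_scaleR_left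
            has_derivative_ident derN derg that)
      then show ?thesis
        by simp
    qed
    \<comment> \<open>The differentiated equation reads
      \<open>s *\<^sub>R f' z w + g' 0 s = 0\<close> at the origin, and \<open>w\<close> lies in the
      kernel; hence the correction \<open>N (g t)\<close> does not alter the velocity
      \<open>w\<close>.\<close>
    have "g' 0 s = 0" for s
      using fc'[OF V(2), of s] by (simp add: g0 c0 linear_add[OF linf] linear_scale[OF linf] w fN)
    then have "(\<gamma> has_vector_derivative w) (at 0)"
      using der\<gamma>[OF V(2)] by (simp add: has_vector_derivative_def linear_0[OF N(1)])
    moreover have "continuous_on {-e<..<e} \<gamma>"
      using has_derivative_continuous[OF der\<gamma>] e(2) by (intro continuous_at_imp_continuous_on) auto
    moreover have "f (\<gamma> t) = 0" if "t \<in> {-e<..<e}" for t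
      using fc[of t] e(2) that by (auto simp: c_def \<gamma>_def)
    moreover have "\<gamma> 0 = z"
      by (simp add: \<gamma>_def g0 linear_0[OF N(1)])
    ultimately show thesis
      using that e(1) by blast
  qed
qed

section \<open>Branch points of the projection\<close>

lemma tangent_vector_in_kernel:
  assumes der: "(f has_derivative D) (at z)" and v: "v \<in> tangent_space (f -` {0}) z"
  shows "D v = 0"
proof -
  obtain \<gamma> :: "real \<Rightarrow> 'a" and e where e: "0 < e" and \<gamma>: "\<gamma> ` {-e<..<e} \<subseteq> f -` {0}" "\<gamma> 0 = z"
    "(\<gamma> has_vector_derivative v) (at 0)"
    using v unfolding tangent_space_def by blast
  have "(f \<circ> \<gamma> has_derivative D \<circ> (\<lambda>t. t *\<^sub>R v)) (at 0)"
    by (rule diff_chain_at[OF \<gamma>(3)[unfolded has_vector_derivative_def]]) (simp add: \<gamma>(2) der)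
  moreover have "(f \<circ> \<gamma> has_derivative (\<lambda>t. 0)) (at 0)"
  proof (rule has_derivative_transform_within_open[OF has_derivative_const open_greaterThanLessThan])
    show "0 \<in> {-e<..<e}"
      using e by simp
    show "0 = (f \<circ> \<gamma>) t" if "t \<in> {-e<..<e}" for t
      using \<gamma>(1) that by fastforce
  qed
  ultimately have "D \<circ> (\<lambda>t. t *\<^sub>R v) = (\<lambda>t. 0)"
    by (rule has_derivative_unique)
  from fun_cong[OF this, of 1] show ?thesis
    by simp
qed

text \<open>Near \<open>(a, b)\<close> the zero set is the graph of an implicit function over an
  open set. For the tangent space, injectivity of \<open>fst\<close> comes from the kernel of
  \<open>f'\<close>, and surjectivity from lifting straight lines to the graph.\<close>

lemma local_homeomorphism_and_regular_point:
  fixes f :: "'a::euclidean_space \<times> 'b::euclidean_space \<Rightarrow> 'b"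
  assumes der: "\<And>z. (f has_derivative f' z) (at z)"
    and cont: "\<And>v. continuous_on UNIV (\<lambda>z. f' z v)"
    and zero: "f (a, b) = 0" and inj: "inj (\<lambda>q. f' (a, b) (0, q))"
  shows "local_homeomorphism_at (f -` {0}) fst (a, b)" "regular_point (f -` {0}) fst (a, b)"
proof -
  obtain U V g g' where U: "open U" "(a, b) \<in> U" and V: "open V" "a \<in> V" and ga: "g a = b"
    and gU: "\<And>x. x \<in> V \<Longrightarrow> (x, g x) \<in> U" and fg: "\<And>x. x \<in> V \<Longrightarrow> f (x, g x) = 0"
    and zeros: "\<And>x q. (x, q) \<in> U \<Longrightarrow> f (x, q) = 0 \<Longrightarrow> x \<in> V \<and> q = g x"
    and derg: "\<And>x. x \<in> V \<Longrightarrow> (g has_derivative g' x) (at x)"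
    and fg': "\<And>x v. x \<in> V \<Longrightarrow> f' (x, g x) (v, g' x v) = 0"
    and contg': "\<And>v. continuous_on V (\<lambda>x. g' x v)"
    by (rule implicit_function[OF der cont zero inj]) (rule that)
  have contg: "continuous_on V g"
    using has_derivative_continuous[OF derg] by (intro continuous_at_imp_continuous_on) auto
  show "local_homeomorphism_at (f -` {0}) fst (a, b)"
    unfolding local_homeomorphism_at_def
  proof (intro exI conjI)
    show "openin (top_of_set (f -` {0})) (f -` {0} \<inter> U)"
      using U(1) by (rule openin_open_Int)
    show "(a, b) \<in> f -` {0} \<inter> U"
      using U(2) zero by simp
    show "open V"
      by (rule V(1))
    show "homeomorphism (f -` {0} \<inter> U) V fst (\<lambda>x. (x, g x))"
      unfolding homeomorphism_def
      using zeros gU fg by (auto intro!: continuous_intros contg image_eqI)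
  qed
  have linf: "linear (f' z)" for z
    using der has_derivative_linear by blast
  have "inj_on fst (tangent_space (f -` {0}) (a, b))"
  proof (rule inj_onI)
    fix v w
    assume "v \<in> tangent_space (f -` {0}) (a, b)" "w \<in> tangent_space (f -` {0}) (a, b)" and eq: "fst v = fst w"
    then have "f' (a, b) (v - w) = 0"
      using tangent_vector_in_kernel[OF der] by (simp add: linear_diff[OF linf])
    moreover have vw: "v - w = (0, snd v - snd w)"
      using eq by (simp add: prod_eq_iff)
    ultimately have "f' (a, b) (0, snd v - snd w) = f' (a, b) (0, 0)"
      using linear_0[OF linf] by (simp add: zero_prod_def)
    then have "snd v - snd w = 0"
      using injD[OF inj] by blast
    then show "v = w"
      using eq by (simp add: prod_eq_iff)
  qed
  moreover have "\<exists>w. (v, w) \<in> tangent_space (f -` {0}) (a, b)" for v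
  proof -
    have "open ((\<lambda>t::real. a + t *\<^sub>R v) -` V)"
      using V(1) by (intro open_vimage continuous_intros)
    then obtain e where e: "0 < e" "ball 0 e \<subseteq> (\<lambda>t::real. a + t *\<^sub>R v) -` V"
      using V(2) by (metis (no_types, lifting) add.right_neutral open_contains_ball scaleR_zero_left vimageI)
    then have eV: "a + t *\<^sub>R v \<in> V" if "t \<in> {-e<..<e}" for t
      using that by (auto simp: ball_eq_greaterThanLessThan)
    \<comment> \<open>Continuity of \<open>g'\<close> is what makes this lift a \<open>C1\<close>
      curve, as \<open>tangent_space\<close> demands.\<close>
    define \<gamma> where "\<gamma> t = (a + t *\<^sub>R v, g (a + t *\<^sub>R v))" for t
    have der\<gamma>: "(\<gamma> has_vector_derivative (v, g' (a + t *\<^sub>R v) v)) (at t)" if "t \<in> {-e<..<e}" for t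
    proof -
      have lin: "((\<lambda>t. a + t *\<^sub>R v) has_derivative (\<lambda>s. 0 + s *\<^sub>R v)) (at t)"
        by (intro has_derivative_add has_derivative_const has_derivative_scaleR_left has_derivative_ident)
      have "((\<lambda>t. g (a + t *\<^sub>R v)) has_derivative (\<lambda>s. g' (a + t *\<^sub>R v) (0 + s *\<^sub>R v))) (at t)"
        by (rule has_derivative_compose[OF lin derg[OF eV[OF that]]])
      then have "(\<gamma> has_derivative (\<lambda>s. (0 + s *\<^sub>R v, g' (a + t *\<^sub>R v) (0 + s *\<^sub>R v)))) (at t)"
        unfolding \<gamma>_def by (rule has_derivative_Pair[OF lin])
      then show ?thesis
        using linear_scale[OF has_derivative_linear[OF derg[OF eV[OF that]]]]
        by (simp add: has_vector_derivative_def scaleR_prod_def)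
    qed
    moreover have "continuous_on {-e<..<e} (\<lambda>t. (v, g' (a + t *\<^sub>R v) v))"
      using eV by (intro continuous_intros continuous_on_compose2[OF contg']) auto
    ultimately have "\<gamma> C1_differentiable_on {-e<..<e}"
      unfolding C1_differentiable_on_def by (intro exI[of _ "\<lambda>t. (v, g' (a + t *\<^sub>R v) v)"]) simp
    moreover have "\<gamma> ` {-e<..<e} \<subseteq> f -` {0}"
      using eV fg by (auto simp: \<gamma>_def)
    moreover have "\<gamma> 0 = (a, b)"
      by (simp add: \<gamma>_def ga)
    moreover have "(\<gamma> has_vector_derivative (v, g' a v)) (at 0)"
      using der\<gamma>[of 0] e(1) by simp
    ultimately show ?thesis
      unfolding tangent_space_def using e(1) by blast
  qed
  then have "fst ` tangent_space (f -` {0}) (a, b) = UNIV"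
    by force
  moreover have "frechet_derivative fst (at (a, b)) = (fst :: 'a \<times> 'b \<Rightarrow> 'a)"
    by (rule frechet_derivative_at[symmetric]) (intro derivative_intros)
  ultimately show "regular_point (f -` {0}) fst (a, b)"
    using zero by (simp add: regular_point_def bij_betw_def)
qed

section \<open>Topology of the complement of the branch set\<close>

text \<open>One chart witnesses the local homeomorphism property at all of its points.\<close>

lemma openin_non_branch_points:
  assumes "openin (top_of_set M) U" "homeomorphism U V f g" "open V"
  shows "U \<subseteq> M - branch_points M f"
proof
  fix z assume "z \<in> U"
  moreover have "U \<subseteq> M"
    using assms(1) openin_imp_subset by blast
  moreover have "local_homeomorphism_at M f z"
    using assms \<open>z \<in> U\<close> unfolding local_homeomorphism_at_def by blast
  ultimately show "z \<in> M - branch_points M f"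
    by (auto simp: branch_points_def)
qed

text \<open>Charts identify neighbourhoods with open sets of a normed space. This later allows
  passing from distinct path components to disconnectedness.\<close>

lemma locally_path_connected_non_branch_points:
  fixes f :: "'a::metric_space \<Rightarrow> 'b::real_normed_vector"
  shows "locally path_connected (M - branch_points M f)"
  unfolding locally_def
proof (intro allI impI)
  fix w x
  assume wx: "openin (top_of_set (M - branch_points M f)) w \<and> x \<in> w"
  then have "x \<in> M - branch_points M f"
    using openin_imp_subset by blast
  then obtain U V g where U: "openin (top_of_set M) U" "x \<in> U" and V: "open V" "homeomorphism U V f g"
    by (auto simp: branch_points_def local_homeomorphism_at_def)
  then have sub: "U \<subseteq> M - branch_points M f"
    by (intro openin_non_branch_points)
  then have oU: "openin (top_of_set (M - branch_points M f)) U"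
    using U(1) openin_subset_trans by blast
  have "locally path_connected U"
    using open_imp_locally_path_connected[OF V(1)] homeomorphism_symD[OF V(2)]
    by (rule homeomorphism_locally_imp)
      (meson homeomorphic_def homeomorphic_path_connectedness)
  moreover have "openin (top_of_set U) (w \<inter> U)"
    using wx openin_subtopology_Int_subset sub by (metis inf_commute openin_subset_trans openin_Int oU openin_imp_subset inf_le1)
  ultimately obtain u v where uv: "openin (top_of_set U) u" "path_connected v" "x \<in> u" "u \<subseteq> v" "v \<subseteq> w \<inter> U"
    using wx U(2) unfolding locally_def by (metis IntI)
  then show "\<exists>u v. openin (top_of_set (M - branch_points M f)) u \<and> path_connected v \<and> x \<in> u \<and> u \<subseteq> v \<and> v \<subseteq> w"
    using openin_trans[OF uv(1) oU] by blast
qed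

section \<open>A homotopy invariant of path components off the branch set\<close>

text \<open>Off the branch points \<open>fst\<close> is injective on a piece of the zero set, so a
  point of the path is the only zero in its fibre nearby. Small spheres in the moving fibres
  therefore avoid all zeros, and \<open>f\<close> on them is the homotopy.\<close>

lemma sphere_homotopic_along_path:
  fixes f :: "'a::euclidean_space \<times> 'b::euclidean_space \<Rightarrow> 'b"
  assumes f: "continuous_on UNIV f" and \<gamma>: "path \<gamma>" "path_image \<gamma> \<subseteq> f -` {0} - branch_points (f -` {0}) fst"
  obtains e where "0 < e" "\<And>r. 0 < r \<Longrightarrow> r < e \<Longrightarrow>
    sphere_homotopic (\<lambda>u. f (fst (pathstart \<gamma>), snd (pathstart \<gamma>) + r *\<^sub>R u))
      (\<lambda>u. f (fst (pathfinish \<gamma>), snd (pathfinish \<gamma>) + r *\<^sub>R u))"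
proof -
  define M where "M = f -` {0}"
  define \<G> where "\<G> = {G. open G \<and> inj_on fst (M \<inter> G)}"
  have "path_image \<gamma> \<subseteq> \<Union>\<G>"
  proof
    fix z assume "z \<in> path_image \<gamma>"
    then have "local_homeomorphism_at M fst z"
      using \<gamma>(2) by (auto simp: branch_points_def M_def)
    then obtain U V g where U: "openin (top_of_set M) U" "z \<in> U" "homeomorphism U V fst g"
      unfolding local_homeomorphism_at_def by blast
    then obtain G where "open G" "U = M \<inter> G"
      by (auto simp: openin_open)
    moreover have "inj_on fst U"
      using U(3) unfolding homeomorphism_def by (metis inj_on_def)
    ultimately show "z \<in> \<Union>\<G>"
      using U(2) by (auto simp: \<G>_def)
  qed
  \<comment> \<open>\<open>e\<close> is a Lebesgue number of the cover of the compact path image; it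
    makes the isolation radius uniform.\<close>
  then obtain e where e: "0 < e" "\<And>z. z \<in> path_image \<gamma> \<Longrightarrow> \<exists>G\<in>\<G>. ball z e \<subseteq> G"
    using Heine_Borel_lemma[OF compact_path_image[OF \<gamma>(1)], of \<G>] unfolding \<G>_def by blast
  have "sphere_homotopic (\<lambda>u. f (fst (pathstart \<gamma>), snd (pathstart \<gamma>) + r *\<^sub>R u))
      (\<lambda>u. f (fst (pathfinish \<gamma>), snd (pathfinish \<gamma>) + r *\<^sub>R u))" if r: "0 < r" "r < e" for r
  proof -
    define h where "h y = f (fst (\<gamma> (fst y)), snd (\<gamma> (fst y)) + r *\<^sub>R snd y)" for y :: "real \<times> 'b"
    have cont: "continuous_on ({0..1} \<times> sphere 0 1) h"
    proof -
      have "continuous_on ({0..1} \<times> sphere (0::'b) 1) (\<lambda>y. \<gamma> (fst y))"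
        using \<gamma>(1) unfolding path_def
        by (rule continuous_on_compose2) (auto intro!: continuous_intros)
      then show ?thesis
        unfolding h_def by (intro continuous_on_compose2[OF f] continuous_intros) auto
    qed
    have "h (t, u) \<noteq> 0" if t: "t \<in> {0..1}" and u: "norm u = 1" for t u
    proof
      assume h0: "h (t, u) = 0"
      have "\<gamma> t \<in> path_image \<gamma>"
        using t by (simp add: path_image_def)
      then obtain G where G: "G \<in> \<G>" "ball (\<gamma> t) e \<subseteq> G" and "\<gamma> t \<in> M"
        using e(2) \<gamma>(2) by (fastforce simp: M_def)
      define z where "z = (fst (\<gamma> t), snd (\<gamma> t) + r *\<^sub>R u)"
      have "z \<in> M"
        using h0 by (simp add: h_def z_def M_def)
      have "dist (\<gamma> t) z = r"
        using u r by (cases "\<gamma> t") (simp add: z_def dist_Pair_Pair dist_norm)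
      then have "z \<in> G" "\<gamma> t \<in> G"
        using subsetD[OF G(2), of z] subsetD[OF G(2), of "\<gamma> t"] r e(1) by simp_all
      then have "z = \<gamma> t"
        using G(1) \<open>z \<in> M\<close> \<open>\<gamma> t \<in> M\<close> unfolding \<G>_def inj_on_def z_def by auto
      then show False
        using \<open>dist (\<gamma> t) z = r\<close> r by simp
    qed
    then have "h \<in> {0..1} \<times> sphere 0 1 \<rightarrow> - {0}"
      by auto
    then show ?thesis
      unfolding sphere_homotopic_def homotopic_with_def
      using cont
      by (intro exI[of _ h]) (auto simp: h_def pathstart_def pathfinish_def prod_topology_subtopology subtopology_subtopology Times_Int_Times)
  qed
  then show thesis
    using that e(1) by blast
qed

text \<open>On the sphere of radius \<open>r\<close> the Taylor error is at most
  \<open>(c / 2) * r\<close>, while the linear term has norm at least \<open>c * r\<close>, with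
  \<open>c\<close> the lower bound of the partial differential. The factor \<open>r\<close> is then
  scaled away.\<close>

lemma sphere_homotopic_derivative:
  fixes f :: "'a::euclidean_space \<times> 'b::euclidean_space \<Rightarrow> 'b"
  assumes f: "continuous_on UNIV f" and der: "(f has_derivative D) (at (a, b))" and zero: "f (a, b) = 0"
    and inj: "inj (\<lambda>q. D (0, q))"
  obtains e where "0 < e" "\<And>r. 0 < r \<Longrightarrow> r < e \<Longrightarrow>
    sphere_homotopic (\<lambda>u. f (a, b + r *\<^sub>R u)) (\<lambda>u. D (0, u))"
proof -
  have linD: "linear D"
    using der has_derivative_linear by blast
  have lin: "linear (\<lambda>q. D (0, q))"
    by (rule linear_compose[OF _ linD, unfolded o_def]) (simp add: linear_iff)
  obtain c where c: "0 < c" "\<And>u. c * norm u \<le> norm (D (0, u))"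
    using linear_inj_bounded_below_pos[OF lin inj] by metis
  obtain e where e: "0 < e" "\<And>z. norm (z - (a, b)) < e \<Longrightarrow>
      norm (f z - f (a, b) - D (z - (a, b))) \<le> (c / 2) * norm (z - (a, b))"
    using der c(1) unfolding has_derivative_at_alt by (metis half_gt_zero)
  have contD: "continuous_on (sphere 0 1) (\<lambda>u. D (0, u))"
    using linear_continuous_on_compose[OF continuous_on_id lin] .
  have "sphere_homotopic (\<lambda>u. f (a, b + r *\<^sub>R u)) (\<lambda>u. D (0, u))" if r: "0 < r" "r < e" for r
  proof -
    have D0: "D (0, u) \<noteq> 0" if "norm u = 1" for u
      using c(1) c(2)[of u] that by auto
    have "sphere_homotopic (\<lambda>u. D (0, u)) (\<lambda>u. r *\<^sub>R D (0, u))"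
      by (rule sphere_homotopic_scaleR[OF contD]) (use D0 r in \<open>auto intro!: continuous_intros\<close>)
    moreover have "sphere_homotopic (\<lambda>u. r *\<^sub>R D (0, u)) (\<lambda>u. f (a, b + r *\<^sub>R u))"
    proof (rule sphere_homotopic_nearby)
      show "continuous_on (sphere 0 1) (\<lambda>u. r *\<^sub>R D (0, u))"
        by (intro continuous_intros contD)
      show "continuous_on (sphere 0 1) (\<lambda>u. f (a, b + r *\<^sub>R u))"
        by (intro continuous_on_compose2[OF f] continuous_intros) auto
      show "norm (r *\<^sub>R D (0, u) - f (a, b + r *\<^sub>R u)) < norm (r *\<^sub>R D (0, u))" if u: "norm u = 1" for u
      proof -
        have "norm ((0::'a, r *\<^sub>R u)) = r"
          using u r by simp
        moreover have "D (0, r *\<^sub>R u) = r *\<^sub>R D (0, u)"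
          using linear_scale[OF lin] by blast
        ultimately have "norm (f (a, b + r *\<^sub>R u) - r *\<^sub>R D (0, u)) \<le> (c / 2) * r"
          using e(2)[of "(a, b + r *\<^sub>R u)"] zero r by simp
        moreover have "(c / 2) * r < r * c"
          using c(1) r by simp
        moreover have "r * c \<le> norm (r *\<^sub>R D (0, u))"
          using c(2)[of u] u r by simp
        ultimately show ?thesis
          unfolding norm_minus_commute[of "r *\<^sub>R D (0, u)"] by linarith
      qed
    qed
    ultimately show ?thesis
      using sphere_homotopic_sym sphere_homotopic_trans by blast
  qed
  then show thesis
    using that e(1) by blast
qed

text \<open>A common small radius links three homotopies: from the differential at \<open>y\<close>
  to increments of \<open>f\<close> there, along the path, and to the differential at
  \<open>z\<close>.\<close>

lemma path_component_non_branch_points_sphere_homotopic: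
  fixes f :: "'a::euclidean_space \<times> 'b::euclidean_space \<Rightarrow> 'b"
  assumes der: "\<And>z. (f has_derivative f' z) (at z)"
    and path: "path_component (f -` {0} - branch_points (f -` {0}) fst) y z"
    and inj: "inj (\<lambda>q. f' y (0, q))" "inj (\<lambda>q. f' z (0, q))"
  shows "sphere_homotopic (\<lambda>q. f' y (0, q)) (\<lambda>q. f' z (0, q))"
proof -
  have cont: "continuous_on UNIV f"
    using has_derivative_continuous[OF der] by (intro continuous_at_imp_continuous_on) auto
  obtain \<gamma> where \<gamma>: "path \<gamma>" "path_image \<gamma> \<subseteq> f -` {0} - branch_points (f -` {0}) fst"
    "pathstart \<gamma> = y" "pathfinish \<gamma> = z"
    using path unfolding path_component_def by blast
  have zero: "f y = 0" "f z = 0"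
    using \<gamma> pathstart_in_path_image pathfinish_in_path_image by fastforce+
  obtain e where e: "0 < e" "\<And>r. 0 < r \<Longrightarrow> r < e \<Longrightarrow>
      sphere_homotopic (\<lambda>u. f (fst y, snd y + r *\<^sub>R u)) (\<lambda>u. f (fst z, snd z + r *\<^sub>R u))"
    using sphere_homotopic_along_path[OF cont \<gamma>(1,2)] unfolding \<gamma>(3,4) by blast
  obtain d where d: "0 < d" "\<And>r. 0 < r \<Longrightarrow> r < d \<Longrightarrow>
      sphere_homotopic (\<lambda>u. f (fst y, snd y + r *\<^sub>R u)) (\<lambda>u. f' y (0, u))"
    using sphere_homotopic_derivative[of f "f' y" "fst y" "snd y"] cont der zero inj by (metis prod.collapse)
  obtain c where c: "0 < c" "\<And>r. 0 < r \<Longrightarrow> r < c \<Longrightarrow>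
      sphere_homotopic (\<lambda>u. f (fst z, snd z + r *\<^sub>R u)) (\<lambda>u. f' z (0, u))"
    using sphere_homotopic_derivative[of f "f' z" "fst z" "snd z"] cont der zero inj by (metis prod.collapse)
  obtain r where r: "0 < r" "r < e" "r < d" "r < c"
    using e(1) d(1) c(1) by (intro that[of "min e (min d c) / 2"]) auto
  show ?thesis
    using sphere_homotopic_sym[OF d(2)[OF r(1,3)]] e(2)[OF r(1,2)] c(2)[OF r(1,4)]
    by (rule sphere_homotopic_trans[OF sphere_homotopic_trans])
qed

section \<open>The curve through the degenerate point and the conclusions\<close>

lemma smooth_map_derivatives:
  assumes "smooth_map f"
  shows "(f has_derivative frechet_derivative f (at z)) (at z)"
    and "continuous_on UNIV (\<lambda>z. frechet_derivative f (at z) v)"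
    and "(\<lambda>z. frechet_derivative f (at z) v) differentiable (at z)"
proof -
  have "Ck_map (Suc 0) f" "Ck_map (Suc (Suc 0)) f"
    using assms unfolding smooth_map_def by blast+
  then show "(f has_derivative frechet_derivative f (at z)) (at z)"
    and "continuous_on UNIV (\<lambda>z. frechet_derivative f (at z) v)"
    and "(\<lambda>z. frechet_derivative f (at z) v) differentiable (at z)"
    by (simp_all add: frechet_derivative_works[symmetric])
qed

theorem theorem2p13:
  fixes f :: "(real ^ 'm) \<times> (real ^ 'k) \<Rightarrow> real ^ 'k"
    and M \<B> :: "((real ^ 'm) \<times> (real ^ 'k)) set"
    and x\<^sub>0 :: "real ^ 'm" and p\<^sub>0 :: "real ^ 'k"
    and L :: "real ^ 'k \<Rightarrow> real ^ 'k"
  assumes f_smooth: "smooth_map f"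
    and regular: "regular_value f 0"
    and M_eq: "M = f -` {0}"
    and M_connected: "connected M"
    and M_bounded: "locally_bounded_over_base M"
    and B_eq: "\<B> = branch_points M fst"
    and m_in: "(x\<^sub>0, p\<^sub>0) \<in> M"
    and L_eq: "L = frechet_derivative (\<lambda>p. f (x\<^sub>0, p)) (at p\<^sub>0)"
    and odd_ker: "odd (dim {u. L u = 0})"
    and second_order: "\<exists>v. L v = 0 \<and>
      (\<forall>u. L u = 0 \<and> u \<noteq> 0 \<longrightarrow> second_differential (\<lambda>p. f (x\<^sub>0, p)) p\<^sub>0 v u \<notin> range L)"
  shows "(x\<^sub>0, p\<^sub>0) \<in> \<B>
    \<and> (\<forall>W. openin (top_of_set M) W \<and> (x\<^sub>0, p\<^sub>0) \<in> W \<longrightarrow>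
         (\<exists>m\<^sub>1 m\<^sub>2. m\<^sub>1 \<in> W \<and> m\<^sub>2 \<in> W \<and> regular_point M fst m\<^sub>1 \<and> regular_point M fst m\<^sub>2 \<and>
            m\<^sub>1 \<in> M - \<B> \<and> m\<^sub>2 \<in> M - \<B> \<and> \<not> path_component (M - \<B>) m\<^sub>1 m\<^sub>2))
    \<and> \<not> connected (M - \<B>)"
proof -
  define f' where "f' z = frechet_derivative f (at z)" for z
  note der = smooth_map_derivatives(1)[OF f_smooth, folded f'_def]
  note cont = smooth_map_derivatives(2)[OF f_smooth, folded f'_def]
  define m where "m = (x\<^sub>0, p\<^sub>0)"
  define S where "S = M - \<B>"
  \<comment> \<open>\<open>E u (0, v)\<close> is met in two ways: as the second differential of
    hypothesis (ii), by \<open>D2\<close>, and as the derivative at 0 of the partial differential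
    along the curve, by \<open>derA\<close>. This is how (ii) becomes transversality of the family
    \<open>A\<close>.\<close>
  define E where "E u = frechet_derivative (\<lambda>z. f' z (0, u)) (at m)" for u
  have S: "S = f -` {0} - branch_points (f -` {0}) fst"
    by (simp add: S_def B_eq M_eq)
  have linf: "linear (f' z)" for z
    using der by (rule has_derivative_linear)
  have derE: "((\<lambda>z. f' z (0, u)) has_derivative E u) (at m)" for u
    using smooth_map_derivatives(3)[OF f_smooth] by (simp add: E_def f'_def frechet_derivative_works[symmetric])
  have emb: "((\<lambda>p. (x\<^sub>0, p)) has_derivative (\<lambda>u. (0, u))) (at q)" for q
    by (intro has_derivative_Pair has_derivative_const has_derivative_ident)
  have partial: "frechet_derivative (\<lambda>p. f (x\<^sub>0, p)) (at q) = (\<lambda>u. f' (x\<^sub>0, q) (0, u))" for q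
    by (rule frechet_derivative_at[symmetric]) (rule has_derivative_compose[OF emb der])
  have L: "L = (\<lambda>u. f' m (0, u))"
    by (simp add: L_eq partial m_def)
  have D2: "second_differential (\<lambda>p. f (x\<^sub>0, p)) p\<^sub>0 v u = E u (0, v)" for v u
  proof -
    have "((\<lambda>q. f' (x\<^sub>0, q) (0, u)) has_derivative (\<lambda>v. E u (0, v))) (at p\<^sub>0)"
      by (rule has_derivative_compose[OF emb derE[unfolded m_def]])
    then show ?thesis
      unfolding second_differential_def partial by (simp add: frechet_derivative_at[symmetric])
  qed
  obtain v where v: "f' m (0, v) = 0"
    and transversal: "\<And>u. f' m (0, u) = 0 \<Longrightarrow> u \<noteq> 0 \<Longrightarrow> E u (0, v) \<notin> range (\<lambda>u. f' m (0, u))"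
    using second_order unfolding D2 L by blast
  have zero: "f m = 0"
    using m_in by (simp add: M_eq m_def)
  then have "surj (f' m)"
    using regular unfolding regular_value_def f'_def by blast
  then obtain \<gamma> :: "real \<Rightarrow> _" and e where e: "0 < e" and \<gamma>0: "\<gamma> 0 = m"
    and \<gamma>': "(\<gamma> has_vector_derivative (0, v)) (at 0)" and cont\<gamma>: "continuous_on {-e<..<e} \<gamma>"
    and f\<gamma>: "\<And>t. t \<in> {-e<..<e} \<Longrightarrow> f (\<gamma> t) = 0"
    using curve_in_zero_set[OF der cont zero _ v] by blast
  define A where "A t = (\<lambda>u. f' (\<gamma> t) (0, u))" for t
  have linA: "linear (A t)" for t
    unfolding A_def by (rule linear_compose[OF _ linf, unfolded o_def]) (simp add: linear_iff)
  have derA: "((\<lambda>t. A t u) has_vector_derivative E u (0, v)) (at 0)" for u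
  proof -
    have "((\<lambda>t. A t u) has_derivative (\<lambda>t. E u (t *\<^sub>R (0, v)))) (at 0)"
      unfolding A_def
      by (rule has_derivative_compose[OF \<gamma>'[unfolded has_vector_derivative_def]]) (simp add: \<gamma>0 derE)
    then show ?thesis
      by (simp only: has_vector_derivative_def linear_scale[OF has_derivative_linear[OF derE]])
  qed
  have "A 0 = (\<lambda>u. f' m (0, u))"
    by (simp add: A_def \<gamma>0)
  then have transversalA: "\<And>u. A 0 u = 0 \<Longrightarrow> u \<noteq> 0 \<Longrightarrow> E u (0, v) \<notin> range (A 0)"
    and oddA: "odd (dim {u. A 0 u = 0})"
    using transversal odd_ker by (simp_all add: L)
  obtain \<delta> where \<delta>: "0 < \<delta>"
    "\<And>t. 0 < t \<Longrightarrow> t < \<delta> \<Longrightarrow> inj (A t) \<and> inj (A (- t)) \<and> \<not> sphere_homotopic (A t) (A (- t))"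
    using linear_path_not_sphere_homotopic[OF linA derA transversalA oddA] by blast
  have regular_points: "regular_point M fst (\<gamma> t) \<and> \<gamma> t \<in> S" if "f (\<gamma> t) = 0" "inj (A t)" for t
    using that local_homeomorphism_and_regular_point[OF der cont, of "fst (\<gamma> t)" "snd (\<gamma> t)"]
    by (simp add: A_def S M_eq branch_points_def)
  \<comment> \<open>The whole arc is kept inside \<open>W\<close>, not only its end points, since
    the proof that \<open>m\<close> is a branch point travels along it.\<close>
  have separated: "\<exists>t>0. \<gamma> ` {-t..t} \<subseteq> M \<inter> W \<and> continuous_on {-t..t} \<gamma>
      \<and> regular_point M fst (\<gamma> t) \<and> regular_point M fst (\<gamma> (- t)) \<and> \<gamma> t \<in> S \<and> \<gamma> (- t) \<in> S
      \<and> \<not> path_component S (\<gamma> t) (\<gamma> (- t))" if W: "open W" "m \<in> W" for W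
  proof -
    obtain r where r: "0 < r" "ball m r \<subseteq> W"
      using W open_contains_ball by blast
    have "isCont \<gamma> 0"
      using \<gamma>' by (rule has_vector_derivative_continuous)
    then obtain d where d: "0 < d" "\<And>t. \<bar>t\<bar> < d \<Longrightarrow> dist (\<gamma> t) m < r"
      using r(1) unfolding continuous_at_eps_delta \<gamma>0 by (auto simp: dist_real_def)
    \<comment> \<open>Below \<open>d\<close> the arc stays in \<open>W\<close>, below
      \<open>e\<close> it lies in the zero set, and below \<open>\<delta>\<close> the partial
      differentials at the two ends are invertible and not homotopic.\<close>
    define t where "t = min d (min e \<delta>) / 2"
    have t: "0 < t" "t < d" "t < e" "t < \<delta>"
      using d e \<delta>(1) by (auto simp: t_def)
    have sub: "{-t..t} \<subseteq> {-e<..<e}"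
      using t by auto
    have "\<gamma> s \<in> M \<inter> W" if "s \<in> {-t..t}" for s
      using f\<gamma>[of s] d(2)[of s] subsetD[OF r(2), of "\<gamma> s"] that t by (simp add: M_eq dist_commute abs_if)
    then have "\<gamma> ` {-t..t} \<subseteq> M \<inter> W"
      by blast
    moreover have "f (\<gamma> t) = 0" "f (\<gamma> (- t)) = 0"
      using f\<gamma> t by auto
    moreover have "\<not> path_component S (\<gamma> t) (\<gamma> (- t))"
      using path_component_non_branch_points_sphere_homotopic[OF der, of "\<gamma> t" "\<gamma> (- t)"] \<delta>(2)[OF t(1,4)]
      by (auto simp: S A_def)
    ultimately show ?thesis
      using regular_points \<delta>(2)[OF t(1,4)] t(1) continuous_on_subset[OF cont\<gamma> sub] by blast
  qed
  have "m \<in> \<B>"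
  proof (rule ccontr)
    assume "m \<notin> \<B>"
    then have "local_homeomorphism_at M fst m"
      using zero by (simp add: B_eq branch_points_def M_eq)
    then obtain U V g where U: "openin (top_of_set M) U" "m \<in> U" and "open V" "homeomorphism U V fst g"
      unfolding local_homeomorphism_at_def by blast
    \<comment> \<open>A chart around \<open>m\<close> would contain no branch point, so a short arc
      inside it would join its two ends within \<open>S\<close>.\<close>
    then have US: "U \<subseteq> S"
      unfolding S_def B_eq by (intro openin_non_branch_points)
    obtain W where W: "open W" "U = M \<inter> W"
      using U(1) by (auto simp: openin_open)
    then obtain t where t: "0 < t" "\<gamma> ` {-t..t} \<subseteq> M \<inter> W" "continuous_on {-t..t} \<gamma>"
      "\<not> path_component S (\<gamma> t) (\<gamma> (- t))"
      using separated[of W] U(2) by blast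
    have "path_connected (\<gamma> ` {-t..t})"
      using t(3) by (intro path_connected_continuous_image) (simp_all add: convex_imp_path_connected)
    moreover have "\<gamma> t \<in> \<gamma> ` {-t..t}" "\<gamma> (- t) \<in> \<gamma> ` {-t..t}"
      using t(1) by auto
    ultimately have "path_component (\<gamma> ` {-t..t}) (\<gamma> t) (\<gamma> (- t))"
      unfolding path_connected_component by blast
    then show False
      using t(2,4) US W(2) path_component_of_subset by blast
  qed
  moreover have pts: "\<exists>m\<^sub>1 m\<^sub>2. m\<^sub>1 \<in> W \<and> m\<^sub>2 \<in> W \<and> regular_point M fst m\<^sub>1 \<and> regular_point M fst m\<^sub>2
      \<and> m\<^sub>1 \<in> S \<and> m\<^sub>2 \<in> S \<and> \<not> path_component S m\<^sub>1 m\<^sub>2"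
    if W: "openin (top_of_set M) W" "m \<in> W" for W
  proof -
    obtain G where G: "open G" "W = M \<inter> G"
      using W(1) by (auto simp: openin_open)
    then obtain t where "0 < t" and t: "\<gamma> ` {-t..t} \<subseteq> W" "regular_point M fst (\<gamma> t)" "regular_point M fst (\<gamma> (- t))"
      "\<gamma> t \<in> S" "\<gamma> (- t) \<in> S" "\<not> path_component S (\<gamma> t) (\<gamma> (- t))"
      using separated[of G] W(2) by blast
    moreover have "\<gamma> t \<in> W" "\<gamma> (- t) \<in> W"
      using t(1) \<open>0 < t\<close> by auto
    ultimately show ?thesis
      by blast
  qed
  moreover have "\<not> connected S"
  proof
    assume "connected S"
    \<comment> \<open>As \<open>S\<close> is locally path connected, its components are its path
      components. The contradiction comes from \<open>pts\<close> with all of \<open>M\<close> as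
      the neighbourhood.\<close>
    then have "path_component S y z" if "y \<in> S" "z \<in> S" for y z
      using that path_component_eq_connected_component_set[OF locally_path_connected_non_branch_points[of M fst], of y]
      unfolding S_def B_eq connected_iff_connected_component by blast
    moreover have "openin (top_of_set M) M" "m \<in> M"
      using zero by (auto simp: M_eq)
    ultimately show False
      using pts by blast
  qed
  ultimately show ?thesis
    unfolding m_def S_def by blast
qed

end
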